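(* Any set $E\in\mathcal{I}\cup\mathcal{I}_{\mathcal{R}}$ (that is, any compact isodiametric set in $\mathbb{H}^n$, and any compact rotationally invariant set that is isodiametric within the class of rotationally invariant sets) is $t$-convex.
   Context: Let $n\ge 1$. The Heisenberg group is $\mathbb{H}^n=\mathbb{C}^n\times\mathbb{R}\approx\mathbb{R}^{2n+1}$ with points $[z,t]$, $z=(z_1,\dots,z_n)$, $z_j=x_j+iy_j$, and group law $[z,t]\cdot[z',t']=[z+z',\,t+t'+2\operatorname{Im} z\overline{z}']$, where $\operatorname{Im} z\overline z'=\sum_j\operatorname{Im} z_j\overline{z}'_j$. Put $X_j=\partial_{x_j}+2y_j\partial_t$, $Y_j=\partial_{y_j}-2x_j\partial_t$. A curve is horizontal if it is absolutely continuous and its tangent vector lies a.e. in $\operatorname{span}\{X_j,Y_j\}_{j}$. Fix the left-invariant Riemannian metric making $(X_1,\dots,X_n,Y_1,\dots,Y_n,\partial_t)$ orthonormal; the Carnot-Carathéodory distance $d(p,q)$ is the infimum of the Riemannian lengths of horizontal curves joining $p$ to $q$. It induces the usual topology. Diameters are with respect to $d$; $\mathcal{L}^{2n+1}$ is Lebesgue (outer) measure on $\mathbb{R}^{2n+1}$. Isodiametric classes: $C_I=\sup\{\mathcal{L}^{2n+1}(F)/(\operatorname{diam}F)^{2n+2} : F\subset\mathbb{H}^n,\ 0<\operatorname{diam}F<+\infty\}$ and $\mathcal{I}=\{E\subset\mathbb{H}^n : E \text{ compact},\ \operatorname{diam}E>0,\ \mathcal{L}^{2n+1}(E)=C_I(\operatorname{diam}E)^{2n+2}\}$.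 For $\theta\in\mathbb{R}^n$ let $r_\theta([z,t])=[(e^{i\theta_1}z_1,\dots,e^{i\theta_n}z_n),t]$, and let $\mathcal{R}=\{F\subset\mathbb{H}^n : r_\theta(F)\subset F\text{ for all }\theta\in\mathbb{R}^n\}$ (rotationally invariant sets). $C_{I,\mathcal{R}}$ is the supremum of $\mathcal{L}^{2n+1}(F)/(\operatorname{diam}F)^{2n+2}$ over $F\in\mathcal{R}$ with $0<\operatorname{diam}F<+\infty$, and $\mathcal{I}_{\mathcal{R}}=\{E\in\mathcal{R} : E\text{ compact},\ \operatorname{diam}E>0,\ \mathcal{L}^{2n+1}(E)=C_{I,\mathcal{R}}(\operatorname{diam}E)^{2n+2}\}$. A set $F\subset\mathbb{H}^n$ is $t$-convex if, whenever $[z,t_1],[z,t_2]\in F$ with $t_1\le t_2$, also $[z,t]\in F$ for all $t\in[t_1,t_2]$. *)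

theory Defs
  imports "HOL-Analysis.Analysis"
begin

type_synonym 'n heis = "(complex ^ 'n) \<times> real"

section \<open>The horizontal frame and the left-invariant metric\<close>

text \<open>Tangent vectors at a point are identified with elements of the ambient vector space.
  With \<open>z\<^sub>j = x\<^sub>j + i y\<^sub>j\<close>, the coordinate direction of \<open>x\<^sub>j\<close> is \<open>axis j 1\<close> and that of
  \<open>y\<^sub>j\<close> is \<open>axis j \<i>\<close>.\<close>

definition X_field :: "'n::finite \<Rightarrow> 'n heis \<Rightarrow> 'n heis" where
  "X_field j p = (axis j 1, 2 * Im (fst p $ j))"

definition Y_field :: "'n::finite \<Rightarrow> 'n heis \<Rightarrow> 'n heis" where
  "Y_field j p = (axis j \<i>, - 2 * Re (fst p $ j))"

definition T_field :: "('n::finite) heis \<Rightarrow> 'n heis" where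
  "T_field p = (0, 1)"

definition horizontal_space :: "('n::finite) heis \<Rightarrow> 'n heis set" where
  "horizontal_space p = span (range (\<lambda>j. X_field j p) \<union> range (\<lambda>j. Y_field j p))"

text \<open>The coefficient of \<^term>\<open>T_field p\<close> when \<open>v\<close> is expanded in the frame at \<open>p\<close>;
  the coefficients of \<^term>\<open>X_field j p\<close> and \<^term>\<open>Y_field j p\<close> are the real and imaginary parts
  of \<^term>\<open>fst v $ j\<close> (see \<open>frame_expansion\<close>).\<close>

definition T_coeff :: "('n::finite) heis \<Rightarrow> 'n heis \<Rightarrow> real" where
  "T_coeff p v = snd v - 2 * (\<Sum>j\<in>UNIV. Im (fst p $ j * cnj (fst v $ j)))"

definition heis_metric :: "('n::finite) heis \<Rightarrow> 'n heis \<Rightarrow> 'n heis \<Rightarrow> real" where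
  "heis_metric p v w = fst v \<bullet> fst w + T_coeff p v * T_coeff p w"

lemma frame_expansion:
  fixes p v :: "('n::finite) heis"
  shows "v = (\<Sum>j\<in>UNIV. Re (fst v $ j) *\<^sub>R X_field j p + Im (fst v $ j) *\<^sub>R Y_field j p)
             + T_coeff p v *\<^sub>R T_field p"
proof (rule prod_eqI)
  have "Re (fst v $ j) *\<^sub>R axis j (1::complex) $ i + Im (fst v $ j) *\<^sub>R axis j \<i> $ i
      = (if j = i then fst v $ i else 0)" for i j
    by (auto simp: axis_def complex_eq_iff)
  then show "fst v = fst ((\<Sum>j\<in>UNIV. Re (fst v $ j) *\<^sub>R X_field j p
      + Im (fst v $ j) *\<^sub>R Y_field j p) + T_coeff p v *\<^sub>R T_field p)"
    by (simp add: vec_eq_iff fst_sum X_field_def Y_field_def T_field_def)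
  show "snd v = snd ((\<Sum>j\<in>UNIV. Re (fst v $ j) *\<^sub>R X_field j p
      + Im (fst v $ j) *\<^sub>R Y_field j p) + T_coeff p v *\<^sub>R T_field p)"
    by (simp add: snd_sum X_field_def Y_field_def T_field_def T_coeff_def sum_distrib_left
        algebra_simps flip: sum.distrib)
qed

lemma T_coeff_frame [simp]:
  fixes p :: "('n::finite) heis"
  shows "T_coeff p (X_field j p) = 0" "T_coeff p (Y_field j p) = 0" "T_coeff p (T_field p) = 1"
proof -
  have *: "(\<Sum>k\<in>UNIV. Im (fst p $ k * cnj (axis j c $ k))) = Im (fst p $ j * cnj c)" for c :: complex
  proof -
    have "Im (fst p $ k * cnj (axis j c $ k)) = (if k = j then Im (fst p $ j * cnj c) else 0)" for k
      by (simp add: axis_def)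
    then show ?thesis by (simp only: sum.delta[OF finite] UNIV_I if_True)
  qed
  show "T_coeff p (X_field j p) = 0" "T_coeff p (Y_field j p) = 0"
    using *[of 1] *[of \<i>] by (simp_all add: T_coeff_def X_field_def Y_field_def)
  show "T_coeff p (T_field p) = 1"
    by (simp add: T_coeff_def T_field_def)
qed

lemma bilinear_heis_metric: "bilinear (heis_metric p)"
proof -
  have "T_coeff p (v + w) = T_coeff p v + T_coeff p w"
       "T_coeff p (c *\<^sub>R v) = c * T_coeff p v" for v w c
    by (simp_all add: T_coeff_def algebra_simps sum.distrib sum_subtractf sum_distrib_left)
  then show ?thesis
    unfolding bilinear_def heis_metric_def
    by (auto intro!: linearI simp: algebra_simps inner_add_left inner_add_right)
qed

lemma heis_metric_orthonormal_frame:
  fixes p :: "('n::finite) heis"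
  shows "heis_metric p (X_field j p) (X_field k p) = (if j = k then 1 else 0)"
    and "heis_metric p (Y_field j p) (Y_field k p) = (if j = k then 1 else 0)"
    and "heis_metric p (X_field j p) (Y_field k p) = 0"
    and "heis_metric p (X_field j p) (T_field p) = 0"
    and "heis_metric p (Y_field j p) (T_field p) = 0"
    and "heis_metric p (T_field p) (T_field p) = 1"
  by (auto simp: heis_metric_def)
     (auto simp: X_field_def Y_field_def T_field_def inner_axis_axis)

section \<open>The Carnot-Caratheodory distance\<close>

definition absolutely_continuous_curve :: "(real \<Rightarrow> 'a::metric_space) \<Rightarrow> real \<Rightarrow> real \<Rightarrow> bool" where
  "absolutely_continuous_curve \<gamma> a b \<longleftrightarrow>
     (\<forall>\<epsilon>>0. \<exists>\<delta>>0. \<forall>S :: (real \<times> real) set.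
        finite S \<and> (\<forall>(u, v)\<in>S. a \<le> u \<and> u \<le> v \<and> v \<le> b) \<and>
        disjoint_family_on (\<lambda>(u, v). {u<..<v}) S \<and> (\<Sum>(u, v)\<in>S. v - u) < \<delta>
        \<longrightarrow> (\<Sum>(u, v)\<in>S. dist (\<gamma> u) (\<gamma> v)) < \<epsilon>)"

definition horizontal_curve :: "(real \<Rightarrow> ('n::finite) heis) \<Rightarrow> real \<Rightarrow> real \<Rightarrow> bool" where
  "horizontal_curve \<gamma> a b \<longleftrightarrow>
     absolutely_continuous_curve \<gamma> a b \<and>
     (AE s in lebesgue. s \<in> {a<..<b} \<longrightarrow>
        (\<exists>v \<in> horizontal_space (\<gamma> s). (\<gamma> has_vector_derivative v) (at s)))"

definition riemannian_length :: "(real \<Rightarrow> ('n::finite) heis) \<Rightarrow> real \<Rightarrow> real \<Rightarrow> ennreal" where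
  "riemannian_length \<gamma> a b =
     (\<integral>\<^sup>+ s \<in> {a<..<b}. ennreal (sqrt (heis_metric (\<gamma> s)
        (vector_derivative \<gamma> (at s)) (vector_derivative \<gamma> (at s)))) \<partial>lebesgue)"

definition cc_dist :: "('n::finite) heis \<Rightarrow> 'n heis \<Rightarrow> ennreal" where
  "cc_dist p q =
     Inf {riemannian_length \<gamma> a b | \<gamma> a b.
            a < b \<and> horizontal_curve \<gamma> a b \<and> \<gamma> a = p \<and> \<gamma> b = q}"

definition cc_diam :: "('n::finite) heis set \<Rightarrow> ennreal" where
  "cc_diam F = (SUP p\<in>F. SUP q\<in>F. cc_dist p q)"

section \<open>Isodiametric classes\<close>

definition rotation :: "real ^ 'n \<Rightarrow> ('n::finite) heis \<Rightarrow> 'n heis" where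
  "rotation \<theta> p = ((\<chi> j. cis (\<theta> $ j) * fst p $ j), snd p)"

definition rotation_invariant_sets :: "('n::finite) heis set set" where
  "rotation_invariant_sets = {F. \<forall>\<theta>. rotation \<theta> ` F \<subseteq> F}"

definition isodiametric_constant :: "('n::finite) heis set set \<Rightarrow> ennreal" where
  "isodiametric_constant \<C> =
     (SUP F \<in> {F \<in> \<C>. 0 < cc_diam F \<and> cc_diam F < \<infinity>}.
        outer_measure_of lebesgue F / cc_diam F ^ (2 * CARD('n) + 2))"

text \<open>Compactness refers to the Euclidean topology of \<open>\<complex>\<^sup>n \<times> \<real>\<close>, which is the one induced by the
  Carnot-Caratheodory distance.\<close>

definition isodiametric_sets_in :: "('n::finite) heis set set \<Rightarrow> 'n heis set set" where
  "isodiametric_sets_in \<C> =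
     {E \<in> \<C>. compact E \<and> 0 < cc_diam E \<and>
        outer_measure_of lebesgue E = isodiametric_constant \<C> * cc_diam E ^ (2 * CARD('n) + 2)}"

definition isodiametric_sets :: "('n::finite) heis set set" where
  "isodiametric_sets = isodiametric_sets_in UNIV"

definition rotation_invariant_isodiametric_sets :: "('n::finite) heis set set" where
  "rotation_invariant_isodiametric_sets = isodiametric_sets_in rotation_invariant_sets"

definition t_convex :: "('n::finite) heis set \<Rightarrow> bool" where
  "t_convex F \<longleftrightarrow>
     (\<forall>z t1 t2 t. (z, t1) \<in> F \<and> (z, t2) \<in> F \<and> t1 \<le> t \<and> t \<le> t2 \<longrightarrow> (z, t) \<in> F)"

end

theory Submission
  imports Defs
begin

text \<open>
  The distance \<open>d(0, [z, t])\<close> is strictly increasing in \<open>|t|\<close> for fixed \<open>z\<close>. Indeed the Koranyi gauge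
  \<open>(|z|\<^sup>4 + t\<^sup>2)\<^sup>1\<^sup>/\<^sup>4\<close> has horizontal gradient of length at most 1, so it is a lower bound for the distance
  and \<open>d(0, [z, t]) > |z|\<close> whenever \<open>t \<noteq> 0\<close>; on the other hand, dilating by \<open>l < 1\<close> and then moving
  along a horizontal segment gives \<open>d(0, [z, l\<^sup>2 t]) \<le> l d(0, [z, t]) + (1 - l) |z|\<close>.

  Suppose now that \<open>[z, t]\<close> lies strictly between two points of an isodiametric set \<open>E\<close> on the same
  vertical line, but not in \<open>E\<close>. By strict monotonicity and left invariance its distance to every point
  of \<open>E\<close> is strictly less than \<open>diam E\<close>, and by compactness this persists in a neighbourhood \<open>U\<close>
  of \<open>[z, t]\<close>. Hence \<open>E \<union> U\<close> has the same diameter as \<open>E\<close> and strictly larger measure, a contradiction.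
  In the rotationally invariant class the same argument is applied to a neighbourhood of the whole
  torus orbit of \<open>[z, t]\<close>.
\<close>

section \<open>Absolutely continuous curves\<close>

text \<open>The definition quantifies over sets of intervals; here the intervals form an indexed family.
  Distinct indices can carry the same interval only if it is degenerate, and then it contributes nothing.\<close>

lemma absolutely_continuous_curveD:
  assumes "absolutely_continuous_curve \<gamma> a b" "e > 0"
  shows "\<exists>d>0. \<forall>I (l :: 'i \<Rightarrow> real) r. finite I \<longrightarrow> (\<forall>i\<in>I. a \<le> l i \<and> l i \<le> r i \<and> r i \<le> b) \<longrightarrow>
      disjoint_family_on (\<lambda>i. {l i<..<r i}) I \<longrightarrow> (\<Sum>i\<in>I. r i - l i) < d \<longrightarrow>
      (\<Sum>i\<in>I. dist (\<gamma> (l i)) (\<gamma> (r i))) < e"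
proof -
  obtain d where "d > 0" and d:
    "\<forall>S. finite S \<and> (\<forall>(u, v)\<in>S. a \<le> u \<and> u \<le> v \<and> v \<le> b) \<and>
          disjoint_family_on (\<lambda>(u, v). {u<..<v}) S \<and> (\<Sum>(u, v)\<in>S. v - u) < d
        \<longrightarrow> (\<Sum>(u, v)\<in>S. dist (\<gamma> u) (\<gamma> v)) < e"
    using assms(1)[unfolded absolutely_continuous_curve_def, rule_format, OF assms(2)] by blast
  show ?thesis
  proof (intro exI conjI allI impI)
    show "d > 0" by fact
    fix I and l r :: "'i \<Rightarrow> real"
    assume fin: "finite I" and lr: "\<forall>i\<in>I. a \<le> l i \<and> l i \<le> r i \<and> r i \<le> b"
      and disj: "disjoint_family_on (\<lambda>i. {l i<..<r i}) I" and small: "(\<Sum>i\<in>I. r i - l i) < d"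
    let ?h = "\<lambda>i. (l i, r i)"
    have degenerate: "l i = r i" if "i \<in> I" "j \<in> I" "i \<noteq> j" "l i = l j" "r i = r j" for i j
    proof -
      have "{l i<..<r i} = {}"
        using disjoint_family_onD[OF disj that(1-3)] that(4,5) by simp
      then show ?thesis using lr that(1) by fastforce
    qed
    have "(\<Sum>(u, v)\<in>?h ` I. v - u) = (\<Sum>i\<in>I. r i - l i)"
      by (subst sum.reindex_nontrivial[OF fin]) (auto dest: degenerate)
    moreover have "disjoint_family_on (\<lambda>(u, v). {u<..<v}) (?h ` I)"
      using disj by (auto simp: disjoint_family_on_def)
    ultimately have "(\<Sum>(u, v)\<in>?h ` I. dist (\<gamma> u) (\<gamma> v)) < e"
      using fin lr small by (intro d[rule_format] conjI) auto
    also have "(\<Sum>(u, v)\<in>?h ` I. dist (\<gamma> u) (\<gamma> v)) = (\<Sum>i\<in>I. dist (\<gamma> (l i)) (\<gamma> (r i)))"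
      by (subst sum.reindex_nontrivial[OF fin]) (auto dest: degenerate)
    finally show "(\<Sum>i\<in>I. dist (\<gamma> (l i)) (\<gamma> (r i))) < e" .
  qed
qed

lemma absolutely_continuous_curve_imp_continuous_on:
  assumes "absolutely_continuous_curve \<gamma> a b"
  shows "continuous_on {a..b} \<gamma>"
  unfolding continuous_on_iff
proof (intro ballI allI impI)
  fix x and e :: real assume x: "x \<in> {a..b}" and "e > 0"
  from absolutely_continuous_curveD[OF assms this(2)] obtain d where "d > 0" and d:
    "\<forall>I (l :: unit \<Rightarrow> real) r. finite I \<longrightarrow> (\<forall>i\<in>I. a \<le> l i \<and> l i \<le> r i \<and> r i \<le> b) \<longrightarrow>
      disjoint_family_on (\<lambda>i. {l i<..<r i}) I \<longrightarrow> (\<Sum>i\<in>I. r i - l i) < d \<longrightarrow>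
      (\<Sum>i\<in>I. dist (\<gamma> (l i)) (\<gamma> (r i))) < e"
    by blast
  have "dist (\<gamma> y) (\<gamma> x) < e" if "y \<in> {a..b}" "dist y x < d" for y
    using d[rule_format, of UNIV "\<lambda>_. min x y" "\<lambda>_. max x y"] x that
    by (cases "x \<le> y") (auto simp: min_def max_def dist_commute dist_real_def disjoint_family_on_def UNIV_unit)
  with \<open>d > 0\<close> show "\<exists>d>0. \<forall>y\<in>{a..b}. dist y x < d \<longrightarrow> dist (\<gamma> y) (\<gamma> x) < e" by blast
qed

text \<open>The Lipschitz bound is asked only on the image of the curve, so functions that are
  Lipschitz merely on bounded sets, such as powers of the gauge, are covered.\<close>

lemma absolutely_continuous_curve_lipschitz_compose:
  assumes \<gamma>: "absolutely_continuous_curve \<gamma> a b" and f: "C-lipschitz_on (\<gamma> ` {a..b}) f"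
  shows "absolutely_continuous_curve (\<lambda>s. f (\<gamma> s)) a b"
  unfolding absolutely_continuous_curve_def
proof (intro allI impI)
  fix e :: real assume "e > 0"
  have C: "C \<ge> 0" using f by (rule lipschitz_on_nonneg)
  \<comment> \<open>\<open>C + 1\<close> instead of \<open>C\<close> because the Lipschitz constant
    may be 0.\<close>
  then have "e / (C + 1) > 0" using \<open>e > 0\<close> by simp
  then obtain d where "d > 0" and d:
    "\<forall>S. finite S \<and> (\<forall>(u, v)\<in>S. a \<le> u \<and> u \<le> v \<and> v \<le> b) \<and>
          disjoint_family_on (\<lambda>(u, v). {u<..<v}) S \<and> (\<Sum>(u, v)\<in>S. v - u) < d
        \<longrightarrow> (\<Sum>(u, v)\<in>S. dist (\<gamma> u) (\<gamma> v)) < e / (C + 1)"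
    using \<gamma>[unfolded absolutely_continuous_curve_def] by blast
  show "\<exists>d>0. \<forall>S. finite S \<and> (\<forall>(u, v)\<in>S. a \<le> u \<and> u \<le> v \<and> v \<le> b) \<and>
      disjoint_family_on (\<lambda>(u, v). {u<..<v}) S \<and> (\<Sum>(u, v)\<in>S. v - u) < d \<longrightarrow>
      (\<Sum>(u, v)\<in>S. dist (f (\<gamma> u)) (f (\<gamma> v))) < e"
  proof (intro exI conjI allI impI)
    fix S assume S: "finite S \<and> (\<forall>(u, v)\<in>S. a \<le> u \<and> u \<le> v \<and> v \<le> b) \<and>
      disjoint_family_on (\<lambda>(u, v). {u<..<v}) S \<and> (\<Sum>(u, v)\<in>S. v - u) < d"
    have "(\<Sum>(u, v)\<in>S. dist (f (\<gamma> u)) (f (\<gamma> v))) \<le> (\<Sum>(u, v)\<in>S. (C + 1) * dist (\<gamma> u) (\<gamma> v))"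
    proof (intro sum_mono, clarify)
      fix u v assume "(u, v) \<in> S"
      then have "dist (f (\<gamma> u)) (f (\<gamma> v)) \<le> C * dist (\<gamma> u) (\<gamma> v)"
        using S by (intro lipschitz_onD[OF f]) auto
      also have "\<dots> \<le> (C + 1) * dist (\<gamma> u) (\<gamma> v)" by (simp add: distrib_right)
      finally show "dist (f (\<gamma> u)) (f (\<gamma> v)) \<le> (C + 1) * dist (\<gamma> u) (\<gamma> v)" .
    qed
    also have "\<dots> = (C + 1) * (\<Sum>(u, v)\<in>S. dist (\<gamma> u) (\<gamma> v))"
      by (simp add: sum_distrib_left split_def)
    also have "\<dots> < (C + 1) * (e / (C + 1))"
      using S C by (intro mult_strict_left_mono d[rule_format]) auto
    finally show "(\<Sum>(u, v)\<in>S. dist (f (\<gamma> u)) (f (\<gamma> v))) < e" using C by simp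
  qed (fact \<open>d > 0\<close>)
qed

lemma absolutely_continuous_curve_id: "absolutely_continuous_curve (\<lambda>s. s) a b"
  unfolding absolutely_continuous_curve_def
proof (intro allI impI)
  fix e :: real assume "e > 0"
  have "(\<Sum>(u, v)\<in>S. dist u v) = (\<Sum>(u, v)\<in>S. v - u)" if "\<forall>(u, v)\<in>S. a \<le> u \<and> u \<le> v \<and> v \<le> b" for S
    using that by (intro sum.cong) (auto simp: dist_real_def)
  with \<open>e > 0\<close> show "\<exists>d>0. \<forall>S. finite S \<and> (\<forall>(u, v)\<in>S. a \<le> u \<and> u \<le> v \<and> v \<le> b) \<and>
      disjoint_family_on (\<lambda>(u, v). {u<..<v}) S \<and> (\<Sum>(u, v)\<in>S. v - u) < d \<longrightarrow>
      (\<Sum>(u, v)\<in>S. dist u v) < e"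
    by (intro exI[of _ e]) auto
qed

lemma absolutely_continuous_curve_shift:
  assumes "absolutely_continuous_curve \<gamma> a b"
  shows "absolutely_continuous_curve (\<lambda>s. \<gamma> (s - k)) (a + k) (b + k)"
  unfolding absolutely_continuous_curve_def
proof (intro allI impI)
  fix e :: real assume "e > 0"
  from absolutely_continuous_curveD[OF assms this] obtain d where "d > 0" and d:
    "\<forall>I (l :: real \<times> real \<Rightarrow> real) r. finite I \<longrightarrow> (\<forall>i\<in>I. a \<le> l i \<and> l i \<le> r i \<and> r i \<le> b) \<longrightarrow>
      disjoint_family_on (\<lambda>i. {l i<..<r i}) I \<longrightarrow> (\<Sum>i\<in>I. r i - l i) < d \<longrightarrow>
      (\<Sum>i\<in>I. dist (\<gamma> (l i)) (\<gamma> (r i))) < e"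
    by blast
  show "\<exists>d>0. \<forall>S. finite S \<and> (\<forall>(u, v)\<in>S. a + k \<le> u \<and> u \<le> v \<and> v \<le> b + k) \<and>
      disjoint_family_on (\<lambda>(u, v). {u<..<v}) S \<and> (\<Sum>(u, v)\<in>S. v - u) < d \<longrightarrow>
      (\<Sum>(u, v)\<in>S. dist (\<gamma> (u - k)) (\<gamma> (v - k))) < e"
  proof (intro exI conjI allI impI)
    fix S assume S: "finite S \<and> (\<forall>(u, v)\<in>S. a + k \<le> u \<and> u \<le> v \<and> v \<le> b + k) \<and>
      disjoint_family_on (\<lambda>(u, v). {u<..<v}) S \<and> (\<Sum>(u, v)\<in>S. v - u) < d"
    have "disjoint_family_on (\<lambda>i. {fst i - k<..<snd i - k}) S"
      unfolding disjoint_family_on_def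
    proof (intro ballI impI)
      fix i j assume "i \<in> S" "j \<in> S" "i \<noteq> j"
      then have "{fst i<..<snd i} \<inter> {fst j<..<snd j} = {}"
        using S by (auto simp: disjoint_family_on_def split_def)
      moreover have "x + k \<in> {fst i<..<snd i} \<inter> {fst j<..<snd j}"
        if "x \<in> {fst i - k<..<snd i - k} \<inter> {fst j - k<..<snd j - k}" for x
        using that by (auto simp: algebra_simps)
      ultimately show "{fst i - k<..<snd i - k} \<inter> {fst j - k<..<snd j - k} = {}" by blast
    qed
    moreover have "a \<le> fst i - k \<and> fst i - k \<le> snd i - k \<and> snd i - k \<le> b" if "i \<in> S" for i
      using S that by (cases i) auto
    moreover have "(\<Sum>i\<in>S. (snd i - k) - (fst i - k)) < d"
      using S by (simp add: split_def)
    ultimately have "(\<Sum>i\<in>S. dist (\<gamma> (fst i - k)) (\<gamma> (snd i - k))) < e"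
      using S by (intro d[rule_format]) auto
    then show "(\<Sum>(u, v)\<in>S. dist (\<gamma> (u - k)) (\<gamma> (v - k))) < e" by (simp add: split_def)
  qed (fact \<open>d > 0\<close>)
qed

text \<open>Every interval is cut at \<open>b\<close> by clamping its endpoints: \<open>min\<close>
  with \<open>b\<close> gives the left part, \<open>max\<close> with \<open>b\<close> the right
  part, and a part on the wrong side degenerates to a point. Each family of parts gets half of
  \<open>e\<close>.\<close>

lemma absolutely_continuous_curve_join:
  assumes ab: "absolutely_continuous_curve \<gamma> a b" and bc: "absolutely_continuous_curve \<gamma> b c"
    and "a \<le> b" "b \<le> c"
  shows "absolutely_continuous_curve \<gamma> a c"
  unfolding absolutely_continuous_curve_def
proof (intro allI impI)
  fix e :: real assume "e > 0"
  then have "e / 2 > 0" by simp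
  from absolutely_continuous_curveD[OF ab this] obtain d1 where "d1 > 0" and d1:
    "\<forall>I (l :: real \<times> real \<Rightarrow> real) r. finite I \<longrightarrow> (\<forall>i\<in>I. a \<le> l i \<and> l i \<le> r i \<and> r i \<le> b) \<longrightarrow>
      disjoint_family_on (\<lambda>i. {l i<..<r i}) I \<longrightarrow> (\<Sum>i\<in>I. r i - l i) < d1 \<longrightarrow>
      (\<Sum>i\<in>I. dist (\<gamma> (l i)) (\<gamma> (r i))) < e / 2"
    by blast
  from absolutely_continuous_curveD[OF bc \<open>e / 2 > 0\<close>] obtain d2 where "d2 > 0" and d2:
    "\<forall>I (l :: real \<times> real \<Rightarrow> real) r. finite I \<longrightarrow> (\<forall>i\<in>I. b \<le> l i \<and> l i \<le> r i \<and> r i \<le> c) \<longrightarrow>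
      disjoint_family_on (\<lambda>i. {l i<..<r i}) I \<longrightarrow> (\<Sum>i\<in>I. r i - l i) < d2 \<longrightarrow>
      (\<Sum>i\<in>I. dist (\<gamma> (l i)) (\<gamma> (r i))) < e / 2"
    by blast
  show "\<exists>d>0. \<forall>S. finite S \<and> (\<forall>(u, v)\<in>S. a \<le> u \<and> u \<le> v \<and> v \<le> c) \<and>
      disjoint_family_on (\<lambda>(u, v). {u<..<v}) S \<and> (\<Sum>(u, v)\<in>S. v - u) < d \<longrightarrow>
      (\<Sum>(u, v)\<in>S. dist (\<gamma> u) (\<gamma> v)) < e"
  proof (intro exI conjI allI impI)
    fix S assume S: "finite S \<and> (\<forall>(u, v)\<in>S. a \<le> u \<and> u \<le> v \<and> v \<le> c) \<and>
      disjoint_family_on (\<lambda>(u, v). {u<..<v}) S \<and> (\<Sum>(u, v)\<in>S. v - u) < min d1 d2"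
    then have i: "a \<le> fst i" "fst i \<le> snd i" "snd i \<le> c" if "i \<in> S" for i
      using that by (cases i; auto)+
    have disj: "{fst i<..<snd i} \<inter> {fst j<..<snd j} = {}" if "i \<in> S" "j \<in> S" "i \<noteq> j" for i j
      using S that by (auto simp: disjoint_family_on_def split_def)
    have small: "(\<Sum>i\<in>S. snd i - fst i) < d1" "(\<Sum>i\<in>S. snd i - fst i) < d2"
      using S by (auto simp: split_def)
    have "(\<Sum>i\<in>S. dist (\<gamma> (min (fst i) b)) (\<gamma> (min (snd i) b))) < e / 2"
    proof (rule d1[rule_format])
      have "(\<Sum>i\<in>S. min (snd i) b - min (fst i) b) \<le> (\<Sum>i\<in>S. snd i - fst i)"
        by (intro sum_mono) (use i in \<open>force simp: min_def\<close>)
      then show "(\<Sum>i\<in>S. min (snd i) b - min (fst i) b) < d1" using small by linarith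
      have "{min (fst i) b<..<min (snd i) b} \<subseteq> {fst i<..<snd i}" for i by auto
      then show "disjoint_family_on (\<lambda>i. {min (fst i) b<..<min (snd i) b}) S"
        using disj unfolding disjoint_family_on_def by blast
      show "a \<le> min (fst i) b \<and> min (fst i) b \<le> min (snd i) b \<and> min (snd i) b \<le> b"
        if "i \<in> S" for i using i[OF that] \<open>a \<le> b\<close> by (force simp: min_def)
    qed (use S in simp)
    moreover have "(\<Sum>i\<in>S. dist (\<gamma> (max (fst i) b)) (\<gamma> (max (snd i) b))) < e / 2"
    proof (rule d2[rule_format])
      have "(\<Sum>i\<in>S. max (snd i) b - max (fst i) b) \<le> (\<Sum>i\<in>S. snd i - fst i)"
        by (intro sum_mono) (use i in \<open>force simp: max_def\<close>)
      then show "(\<Sum>i\<in>S. max (snd i) b - max (fst i) b) < d2" using small by linarith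
      have "{max (fst i) b<..<max (snd i) b} \<subseteq> {fst i<..<snd i}" for i by auto
      then show "disjoint_family_on (\<lambda>i. {max (fst i) b<..<max (snd i) b}) S"
        using disj unfolding disjoint_family_on_def by blast
      show "b \<le> max (fst i) b \<and> max (fst i) b \<le> max (snd i) b \<and> max (snd i) b \<le> c"
        if "i \<in> S" for i using i[OF that] \<open>b \<le> c\<close> by (force simp: max_def)
    qed (use S in simp)
    moreover have "(\<Sum>i\<in>S. dist (\<gamma> (fst i)) (\<gamma> (snd i)))
        \<le> (\<Sum>i\<in>S. dist (\<gamma> (min (fst i) b)) (\<gamma> (min (snd i) b)) + dist (\<gamma> (max (fst i) b)) (\<gamma> (max (snd i) b)))"
    proof (intro sum_mono)
      fix j assume "j \<in> S"
      then show "dist (\<gamma> (fst j)) (\<gamma> (snd j))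
          \<le> dist (\<gamma> (min (fst j) b)) (\<gamma> (min (snd j) b)) + dist (\<gamma> (max (fst j) b)) (\<gamma> (max (snd j) b))"
        using i(2)[of j] by (cases "snd j \<le> b"; cases "fst j \<le> b") (auto simp: dist_triangle)
    qed
    ultimately show "(\<Sum>(u, v)\<in>S. dist (\<gamma> u) (\<gamma> v)) < e" by (simp add: split_def sum.distrib)
  qed (use \<open>d1 > 0\<close> \<open>d2 > 0\<close> in simp)
qed

lemma absolutely_continuous_curve_cong:
  assumes "\<And>s. s \<in> {a..b} \<Longrightarrow> \<gamma> s = \<eta> s" "absolutely_continuous_curve \<eta> a b"
  shows "absolutely_continuous_curve \<gamma> a b"
proof -
  have eq: "(\<Sum>(u, v)\<in>S. dist (\<gamma> u) (\<gamma> v)) = (\<Sum>(u, v)\<in>S. dist (\<eta> u) (\<eta> v))"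
    if "\<forall>(u, v)\<in>S. a \<le> u \<and> u \<le> v \<and> v \<le> b" for S
    by (intro sum.cong) (use that assms(1) in auto)
  show ?thesis
    unfolding absolutely_continuous_curve_def
  proof (intro allI impI)
    fix e :: real assume "e > 0"
    with assms(2) obtain d where "d > 0" "\<forall>S. finite S \<and> (\<forall>(u, v)\<in>S. a \<le> u \<and> u \<le> v \<and> v \<le> b) \<and>
          disjoint_family_on (\<lambda>(u, v). {u<..<v}) S \<and> (\<Sum>(u, v)\<in>S. v - u) < d
        \<longrightarrow> (\<Sum>(u, v)\<in>S. dist (\<eta> u) (\<eta> v)) < e"
      unfolding absolutely_continuous_curve_def by blast
    then show "\<exists>d>0. \<forall>S. finite S \<and> (\<forall>(u, v)\<in>S. a \<le> u \<and> u \<le> v \<and> v \<le> b) \<and>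
          disjoint_family_on (\<lambda>(u, v). {u<..<v}) S \<and> (\<Sum>(u, v)\<in>S. v - u) < d
        \<longrightarrow> (\<Sum>(u, v)\<in>S. dist (\<gamma> u) (\<gamma> v)) < e"
      using eq by (intro exI[of _ d]) simp
  qed
qed

text \<open>The Henstock-Kurzweil proof: the gauge is the straddle gauge off the exceptional null set \<open>N\<close>,
  and on \<open>N\<close> it stays inside a small open neighbourhood of \<open>N\<close>, so that absolute continuity
  controls the increments over the intervals tagged in \<open>N\<close>.\<close>

lemma absolutely_continuous_curve_has_integral:
  fixes f :: "real \<Rightarrow> 'a::banach"
  assumes ac: "absolutely_continuous_curve f a b" and "a \<le> b" and N: "negligible N"
    and f': "\<And>x. x \<in> {a..b} - N \<Longrightarrow> (f has_vector_derivative f' x) (at x)"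
  shows "(f' has_integral f b - f a) {a..b}"
proof -
  \<comment> \<open>Changing \<open>f'\<close> on the null set \<open>N\<close> leaves the integral
    alone, and the value 0 there removes these tags from the Riemann sums.\<close>
  define g where "g x = (if x \<in> N then 0 else f' x)" for x
  have "(g has_integral f b - f a) {a..b}"
    unfolding has_integral_real
  proof (intro allI impI)
    fix e :: real assume "e > 0"
    \<comment> \<open>The summand 1 keeps the denominator positive when
      \<open>a = b\<close>.\<close>
    define e1 where "e1 = e / (2 * (b - a + 1))"
    have "e1 > 0" using \<open>e > 0\<close> \<open>a \<le> b\<close> by (simp add: e1_def)
    have "e1 * (b - a) < e / 2"
      using \<open>e > 0\<close> \<open>a \<le> b\<close> by (simp add: e1_def field_simps)
    have "\<forall>x. \<exists>d>0. x \<in> {a..b} - N \<longrightarrow>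
        (\<forall>y. norm (y - x) < d \<longrightarrow> norm (f y - f x - (y - x) *\<^sub>R f' x) \<le> e1 * norm (y - x))"
      using f' \<open>e1 > 0\<close> unfolding has_vector_derivative_def has_derivative_at_alt
      by (metis zero_less_one)
    then obtain d where d: "\<And>x. 0 < d x"
      "\<And>x y. \<lbrakk>x \<in> {a..b} - N; norm (y - x) < d x\<rbrakk>
        \<Longrightarrow> norm (f y - f x - (y - x) *\<^sub>R f' x) \<le> e1 * norm (y - x)"
      by metis
    have "e / 2 > 0" using \<open>e > 0\<close> by simp
    from absolutely_continuous_curveD[OF ac this] obtain \<delta> where "\<delta> > 0" and \<delta>:
      "\<forall>I (l :: real \<times> real set \<Rightarrow> real) r. finite I \<longrightarrow> (\<forall>i\<in>I. a \<le> l i \<and> l i \<le> r i \<and> r i \<le> b) \<longrightarrow>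
        disjoint_family_on (\<lambda>i. {l i<..<r i}) I \<longrightarrow> (\<Sum>i\<in>I. r i - l i) < \<delta> \<longrightarrow>
        (\<Sum>i\<in>I. dist (f (l i)) (f (r i))) < e / 2"
      by blast
    have "N \<in> sets lebesgue" using N by (simp add: negligible_imp_sets)
    then obtain T where T: "open T" "N \<subseteq> T" "emeasure lebesgue (T - N) < ennreal \<delta>"
      using sets_lebesgue_outer_open[OF _ \<open>\<delta> > 0\<close>] by metis
    have "emeasure lebesgue T = emeasure lebesgue (T - N)"
      using N T by (intro emeasure_Diff_null_set[symmetric])
        (auto simp: negligible_iff_null_sets)
    with T have emT: "emeasure lebesgue T < ennreal \<delta>" by simp
    define G where "G x = (if x \<in> N then T else ball x (d x))" for x
    show "\<exists>G. gauge G \<and> (\<forall>D. D tagged_division_of {a..b} \<and> G fine D \<longrightarrow>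
        norm ((\<Sum>(x, K)\<in>D. measure lborel K *\<^sub>R g x) - (f b - f a)) < e)"
    proof (intro exI conjI allI impI)
      show "gauge G"
        using T d(1) by (auto simp: gauge_def G_def)
      fix D assume D: "D tagged_division_of {a..b} \<and> G fine D"
      then have "finite D" by blast
      define l r where "l i = Inf (snd i)" and "r i = Sup (snd i)" for i :: "real \<times> real set"
      have K: "K = {l (x, K)..r (x, K)}" "l (x, K) \<le> x" "x \<le> r (x, K)" "K \<subseteq> {a..b}" "K \<subseteq> G x" "x \<in> K"
        if xK: "(x, K) \<in> D" for x K
      proof -
        show "x \<in> K" "K \<subseteq> {a..b}" "K \<subseteq> G x" using D xK by (auto simp: fine_def)
        moreover obtain u v where "K = {u..v}"
          using tagged_division_ofD(4)[of D "{a..b}" x K] D xK by auto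
        ultimately show "K = {l (x, K)..r (x, K)}" "l (x, K) \<le> x" "x \<le> r (x, K)"
          by (auto simp: l_def r_def)
      qed
      \<comment> \<open>The error of one tagged interval. Over a division the increments of
        \<open>f\<close> telescope to \<open>f b - f a\<close>, so the errors add up to the total
        error.\<close>
      define h where "h = (\<lambda>(x, K). measure lborel K *\<^sub>R g x - (f (Sup K) - f (Inf K)))"
      define DN where "DN = {i \<in> D. fst i \<in> N}"
      have sumh: "(\<Sum>(x, K)\<in>D. measure lborel K *\<^sub>R g x) - (f b - f a) = sum h D"
        using additive_tagged_division_1[OF \<open>a \<le> b\<close>, of D f] D
        by (simp add: h_def split_def sum_subtractf)
      have "norm (sum h (D - DN)) \<le> (\<Sum>i\<in>D - DN. e1 * (r i - l i))"
      proof (rule sum_norm_le, clarify)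
        fix x K assume xK: "(x, K) \<in> D" "(x, K) \<notin> DN"
        define u v where "u = l (x, K)" and "v = r (x, K)"
        note Kx = K[OF xK(1), folded u_def v_def]
        have x: "x \<in> {a..b} - N" using xK Kx by (auto simp: DN_def)
        have "u \<in> {u..v}" "v \<in> {u..v}" using Kx(2,3) by auto
        then have "u \<in> ball x (d x)" "v \<in> ball x (d x)"
          using Kx(1,5) x unfolding G_def by auto
        then have "norm (f u - f x - (u - x) *\<^sub>R f' x) \<le> e1 * norm (u - x)"
          "norm (f v - f x - (v - x) *\<^sub>R f' x) \<le> e1 * norm (v - x)"
          using d(2)[OF x, of u] d(2)[OF x, of v] by (simp_all add: dist_norm norm_minus_commute)
        \<comment> \<open>The tag lies between \<open>u\<close> and \<open>v\<close>, so the
          distances from \<open>x\<close> in the two remainders add up to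
          \<open>v - u\<close>.\<close>
        moreover have "h (x, K) = (f u - f x - (u - x) *\<^sub>R f' x) - (f v - f x - (v - x) *\<^sub>R f' x)"
        proof -
          have "Inf K = u" "Sup K = v" by (simp_all add: u_def v_def l_def r_def)
          moreover have "measure lborel K = v - u"
            unfolding Kx(1) using Kx(2,3) by simp
          ultimately show ?thesis using x by (simp add: h_def g_def scaleR_left_diff_distrib)
        qed
        then have "norm (h (x, K)) \<le> norm (f u - f x - (u - x) *\<^sub>R f' x) + norm (f v - f x - (v - x) *\<^sub>R f' x)"
          by (simp only: norm_triangle_ineq4)
        ultimately have "norm (h (x, K)) \<le> e1 * norm (u - x) + e1 * norm (v - x)" by linarith
        also have "\<dots> = e1 * (v - u)" using Kx by (simp add: algebra_simps)
        finally show "norm (h (x, K)) \<le> e1 * (r (x, K) - l (x, K))" by (simp add: u_def v_def)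
      qed
      also have "\<dots> \<le> (\<Sum>i\<in>D. e1 * (r i - l i))"
        using \<open>finite D\<close> \<open>e1 > 0\<close> K(2,3) by (intro sum_mono2) (fastforce intro!: mult_nonneg_nonneg)+
      also have "\<dots> = e1 * (b - a)"
        using additive_tagged_division_1[OF \<open>a \<le> b\<close>, of D "\<lambda>x. x"] D
        by (simp add: sum_distrib_left[symmetric] l_def r_def split_def)
      finally have 1: "norm (sum h (D - DN)) \<le> e1 * (b - a)" .
      have disj: "disjoint_family_on (\<lambda>i. {l i<..<r i}) DN"
        unfolding disjoint_family_on_def
      proof (intro ballI impI)
        fix i j assume "i \<in> DN" "j \<in> DN" "i \<noteq> j"
        moreover have "interior (snd i) = {l i<..<r i}" if "i \<in> D" for i
          using K(1)[of "fst i" "snd i"] that by (metis interior_atLeastAtMost_real prod.collapse)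
        ultimately show "{l i<..<r i} \<inter> {l j<..<r j} = {}"
          using D tagged_division_ofD(5)[of D "{a..b}" "fst i" "snd i" "fst j" "snd j"]
          by (auto simp: DN_def)
      qed
      have lr: "a \<le> l i" "l i \<le> r i" "r i \<le> b" "{l i..r i} \<subseteq> G (fst i)" if "i \<in> D" for i
      proof -
        obtain x K where i: "i = (x, K)" by fastforce
        have *: "l i \<le> r i" "{l i..r i} \<subseteq> {a..b}" "{l i..r i} \<subseteq> G (fst i)"
          using K[of x K] that unfolding i by auto
        then show "a \<le> l i" "l i \<le> r i" "r i \<le> b" "{l i..r i} \<subseteq> G (fst i)"
          by auto
      qed
      have "ennreal (\<Sum>i\<in>DN. r i - l i) = (\<Sum>i\<in>DN. emeasure lebesgue {l i<..<r i})"
        using lr by (subst sum_ennreal[symmetric]) (auto simp: DN_def)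
      also have "\<dots> = emeasure lebesgue (\<Union>i\<in>DN. {l i<..<r i})"
        using disj \<open>finite D\<close> by (intro sum_emeasure) (auto simp: DN_def)
      also have "\<dots> \<le> emeasure lebesgue T"
        using lr(4) \<open>open T\<close> by (intro emeasure_mono) (force simp: DN_def G_def)+
      finally have "ennreal (\<Sum>i\<in>DN. r i - l i) < ennreal \<delta>"
        using emT by (rule le_less_trans)
      then have "(\<Sum>i\<in>DN. r i - l i) < \<delta>"
        by (subst (asm) ennreal_less_iff) (auto intro!: sum_nonneg simp: lr(2) DN_def)
      then have "(\<Sum>i\<in>DN. dist (f (l i)) (f (r i))) < e / 2"
        using \<open>finite D\<close> disj lr by (intro \<delta>[rule_format]) (auto simp: DN_def)
      \<comment> \<open>At tags in \<open>N\<close> the function \<open>g\<close> is 0, so only the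
        increment of \<open>f\<close> remains.\<close>
      moreover have "norm (sum h DN) \<le> (\<Sum>i\<in>DN. dist (f (l i)) (f (r i)))"
        by (rule sum_norm_le) (auto simp: h_def DN_def g_def l_def r_def dist_norm)
      moreover have "sum h D = sum h (D - DN) + sum h DN"
        using \<open>finite D\<close> by (intro sum.subset_diff) (auto simp: DN_def)
      ultimately have "norm (sum h D) < e"
        using 1 \<open>e1 * (b - a) < e / 2\<close> norm_triangle_ineq[of "sum h (D - DN)" "sum h DN"]
        by simp
      then show "norm ((\<Sum>(x, K)\<in>D. measure lborel K *\<^sub>R g x) - (f b - f a)) < e"
        unfolding sumh .
    qed
  qed
  then show ?thesis
    by (rule has_integral_spike[OF N, rotated]) (simp add: g_def)
qed

section \<open>Horizontal curves and their lengths\<close>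

text \<open>The imaginary part of the Hermitian product, that is, the standard symplectic form of
  the underlying real space up to sign. It governs both the group law and
  \<open>T_coeff\<close>.\<close>

definition sympl :: "complex ^ 'n::finite \<Rightarrow> complex ^ 'n \<Rightarrow> real" where
  "sympl u v = (\<Sum>j\<in>UNIV. Im (u $ j * cnj (v $ j)))"

lemma bilinear_sympl: "bilinear sympl"
  unfolding bilinear_def sympl_def
  by (auto intro!: linearI simp: algebra_simps sum.distrib sum_subtractf sum_distrib_left)

lemma sympl_simps [simp]:
  "sympl (u + u') v = sympl u v + sympl u' v" "sympl u (v + v') = sympl u v + sympl u v'"
  "sympl (u - u') v = sympl u v - sympl u' v" "sympl u (v - v') = sympl u v - sympl u v'"
  "sympl (- u) v = - sympl u v" "sympl u (- v) = - sympl u v"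
  "sympl (c *\<^sub>R u) v = c * sympl u v" "sympl u (c *\<^sub>R v) = c * sympl u v"
  "sympl 0 v = 0" "sympl u 0 = 0"
  using bilinear_sympl
  by (simp_all add: bilinear_sympl[THEN bilinear_ladd] bilinear_sympl[THEN bilinear_radd]
      bilinear_sympl[THEN bilinear_lsub] bilinear_sympl[THEN bilinear_rsub]
      bilinear_sympl[THEN bilinear_lneg] bilinear_sympl[THEN bilinear_rneg]
      bilinear_sympl[THEN bilinear_lmul] bilinear_sympl[THEN bilinear_rmul]
      bilinear_sympl[THEN bilinear_lzero] bilinear_sympl[THEN bilinear_rzero])

lemma sympl_commute: "sympl u v = - sympl v u"
  by (simp add: sympl_def sum_negf[symmetric] algebra_simps)

lemma sympl_self [simp]: "sympl u u = 0"
  using sympl_commute[of u u] by simp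

lemma T_coeff_eq: "T_coeff p v = snd v - 2 * sympl (fst p) (fst v)"
  by (simp add: T_coeff_def sympl_def)

text \<open>\<open>T_coeff p\<close> is the contact form at \<open>p\<close>: it kills the spanning
  fields, and a vector it kills has only horizontal terms in its frame expansion.\<close>

lemma horizontal_space_eq: "horizontal_space p = {v. T_coeff p v = 0}"
proof (rule antisym)
  have "subspace {v. T_coeff p v = 0}"
    by (auto simp: subspace_def T_coeff_eq algebra_simps)
  then show "horizontal_space p \<subseteq> {v. T_coeff p v = 0}"
    unfolding horizontal_space_def by (intro span_minimal) auto
  show "{v. T_coeff p v = 0} \<subseteq> horizontal_space p"
  proof clarify
    fix v assume "T_coeff p v = 0"
    then have "v = (\<Sum>j\<in>UNIV. Re (fst v $ j) *\<^sub>R X_field j p + Im (fst v $ j) *\<^sub>R Y_field j p)"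
      using frame_expansion[of v p] by simp
    also have "\<dots> \<in> horizontal_space p"
      unfolding horizontal_space_def
      by (intro span_sum span_add span_scale span_base) auto
    finally show "v \<in> horizontal_space p" .
  qed
qed

text \<open>Trades the almost-everywhere statement for an explicit exceptional set and a velocity
  function, the form in which all later proofs handle horizontal curves.\<close>

lemma horizontal_curve_iff:
  "horizontal_curve \<gamma> a b \<longleftrightarrow> absolutely_continuous_curve \<gamma> a b \<and>
     (\<exists>N v. negligible N \<and> (\<forall>s\<in>{a<..<b} - N. (\<gamma> has_vector_derivative v s) (at s) \<and> T_coeff (\<gamma> s) (v s) = 0))"
  (is "_ \<longleftrightarrow> _ \<and> ?R")
proof -
  have "(AE s in lebesgue. s \<in> {a<..<b} \<longrightarrow>
        (\<exists>v \<in> horizontal_space (\<gamma> s). (\<gamma> has_vector_derivative v) (at s))) \<longleftrightarrow> ?R" (is "?L \<longleftrightarrow> _")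
  proof
    assume ?L
    then obtain N where N: "negligible N"
      "{s. \<not> (s \<in> {a<..<b} \<longrightarrow> (\<exists>v \<in> horizontal_space (\<gamma> s). (\<gamma> has_vector_derivative v) (at s)))} \<subseteq> N"
      unfolding eventually_ae_filter_negligible by blast
    have "(\<gamma> has_vector_derivative vector_derivative \<gamma> (at s)) (at s) \<and>
        T_coeff (\<gamma> s) (vector_derivative \<gamma> (at s)) = 0" if "s \<in> {a<..<b} - N" for s
    proof -
      obtain v where "v \<in> horizontal_space (\<gamma> s)" "(\<gamma> has_vector_derivative v) (at s)"
        using N(2) \<open>s \<in> {a<..<b} - N\<close> by blast
      then show ?thesis by (simp add: horizontal_space_eq vector_derivative_at)
    qed
    then show ?R
      by (intro exI[of _ N] exI[of _ "\<lambda>s. vector_derivative \<gamma> (at s)"] conjI ballI N(1)) blast+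
  next
    assume ?R
    then obtain N v where N: "negligible N"
      "\<forall>s\<in>{a<..<b} - N. (\<gamma> has_vector_derivative v s) (at s) \<and> T_coeff (\<gamma> s) (v s) = 0"
      by (elim exE conjE)
    show ?L
      unfolding eventually_ae_filter_negligible
    proof (intro exI conjI subsetI)
      fix s assume "s \<in> {s. \<not> (s \<in> {a<..<b} \<longrightarrow> (\<exists>v \<in> horizontal_space (\<gamma> s). (\<gamma> has_vector_derivative v) (at s)))}"
      then show "s \<in> N" using N(2) unfolding horizontal_space_eq by blast
    qed (fact N(1))
  qed
  then show ?thesis by (simp add: horizontal_curve_def)
qed

text \<open>A horizontal velocity has no component along \<open>T_field\<close>, so its Riemannian
  norm is the Euclidean norm of its projection to the complex coordinates.\<close>

lemma riemannian_length_eq: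
  assumes "negligible N"
    and "\<And>s. s \<in> {a<..<b} - N \<Longrightarrow> (\<gamma> has_vector_derivative v s) (at s) \<and> T_coeff (\<gamma> s) (v s) = 0"
  shows "riemannian_length \<gamma> a b = (\<integral>\<^sup>+ s \<in> {a<..<b}. ennreal (norm (fst (v s))) \<partial>lebesgue)"
  unfolding riemannian_length_def
proof (rule nn_integral_cong_AE)
  have "AE s in lebesgue. s \<notin> N"
    using assms(1) by (auto simp: eventually_ae_filter_negligible)
  then show "AE s in lebesgue. ennreal (sqrt (heis_metric (\<gamma> s) (vector_derivative \<gamma> (at s)) (vector_derivative \<gamma> (at s))))
      * indicator {a<..<b} s = ennreal (norm (fst (v s))) * indicator {a<..<b} s"
  proof (rule AE_mp, intro AE_I2 impI)
    fix s assume "s \<notin> N"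
    show "ennreal (sqrt (heis_metric (\<gamma> s) (vector_derivative \<gamma> (at s)) (vector_derivative \<gamma> (at s))))
      * indicator {a<..<b} s = ennreal (norm (fst (v s))) * indicator {a<..<b} s"
    proof (cases "s \<in> {a<..<b}")
      case True
      then have "(\<gamma> has_vector_derivative v s) (at s)" "T_coeff (\<gamma> s) (v s) = 0"
        using assms(2)[of s] \<open>s \<notin> N\<close> by auto
      then show ?thesis
        by (simp add: vector_derivative_at heis_metric_def norm_eq_sqrt_inner)
    qed simp
  qed
qed

text \<open>Measurability of \<open>v\<close> comes from its integrability, which the fundamental
  theorem for absolutely continuous curves supplies.\<close>

lemma borel_measurable_speed:
  fixes \<gamma> :: "real \<Rightarrow> ('n::finite) heis"
  assumes "absolutely_continuous_curve \<gamma> a b" "negligible N" "a < b"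
    and "\<And>s. s \<in> {a<..<b} - N \<Longrightarrow> (\<gamma> has_vector_derivative v s) (at s)"
  shows "(\<lambda>s. ennreal (norm (fst (v s))) * indicator {a<..<b} s) \<in> borel_measurable lebesgue"
proof -
  have "(v has_integral \<gamma> b - \<gamma> a) {a..b}"
    by (rule absolutely_continuous_curve_has_integral[where N = "N \<union> {a, b}"])
       (use assms in \<open>auto intro: less_imp_le\<close>)
  then have "(v has_integral \<gamma> b - \<gamma> a) {a<..<b}"
    by (simp add: has_integral_Icc_iff_Ioo)
  then have meas: "(\<lambda>s. indicator {a<..<b} s *\<^sub>R v s) \<in> borel_measurable lebesgue"
    by (rule has_integral_implies_lebesgue_measurable)
  have "(\<lambda>s. ennreal (norm (fst (indicator {a<..<b} s *\<^sub>R v s)))) \<in> borel_measurable lebesgue"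
    by (intro measurable_compose[OF meas] measurable_compose[OF _ measurable_ennreal]
        borel_measurable_continuous_onI continuous_intros)
  also have "(\<lambda>s. ennreal (norm (fst (indicator {a<..<b} s *\<^sub>R v s))))
      = (\<lambda>s. ennreal (norm (fst (v s))) * indicator {a<..<b} s)"
    by (auto simp: indicator_def)
  finally show ?thesis .
qed

text \<open>Serves left translations with \<open>m = 1\<close> and dilations with \<open>m\<close>
  the scaling factor. \<open>A\<close> is the differential of \<open>\<phi>\<close>; it keeps
  horizontal vectors horizontal and scales their norm by \<open>m\<close>.\<close>

lemma horizontal_curve_affine_image:
  fixes \<phi> A :: "('n::finite) heis \<Rightarrow> 'n heis"
  assumes "linear A" and \<phi>: "\<And>p. \<phi> p = A p + c" and "m \<ge> 0"
    and T: "\<And>p v. T_coeff p v = 0 \<Longrightarrow> T_coeff (\<phi> p) (A v) = 0"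
    and norm: "\<And>v. norm (fst (A v)) = m * norm (fst v)"
    and hor: "horizontal_curve \<gamma> a b" and "a < b"
  shows "horizontal_curve (\<lambda>s. \<phi> (\<gamma> s)) a b"
    and "riemannian_length (\<lambda>s. \<phi> (\<gamma> s)) a b = ennreal m * riemannian_length \<gamma> a b"
proof -
  have A: "bounded_linear A" using \<open>linear A\<close> by (simp add: linear_conv_bounded_linear)
  obtain N v where ac: "absolutely_continuous_curve \<gamma> a b" and N: "negligible N"
    and v: "\<And>s. s \<in> {a<..<b} - N \<Longrightarrow> (\<gamma> has_vector_derivative v s) (at s) \<and> T_coeff (\<gamma> s) (v s) = 0"
    using hor unfolding horizontal_curve_iff by blast
  have v': "((\<lambda>s. \<phi> (\<gamma> s)) has_vector_derivative A (v s)) (at s) \<and> T_coeff (\<phi> (\<gamma> s)) (A (v s)) = 0"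
    if "s \<in> {a<..<b} - N" for s
    using bounded_linear.has_vector_derivative[OF A conjunct1[OF v[OF that]]] v[OF that] T
    unfolding \<phi> by (auto simp: has_vector_derivative_add_const)
  have "(onorm A)-lipschitz_on (\<gamma> ` {a..b}) \<phi>"
    using A by (intro lipschitz_onI)
      (auto simp: \<phi> dist_norm linear_diff[OF \<open>linear A\<close>, symmetric] onorm onorm_pos_le)
  then have "absolutely_continuous_curve (\<lambda>s. \<phi> (\<gamma> s)) a b"
    by (rule absolutely_continuous_curve_lipschitz_compose[OF ac])
  then show "horizontal_curve (\<lambda>s. \<phi> (\<gamma> s)) a b"
    unfolding horizontal_curve_iff
    by (intro conjI exI[of _ N] exI[of _ "\<lambda>s. A (v s)"] ballI N v'[THEN conjunct1] v'[THEN conjunct2])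
  have L: "riemannian_length \<gamma> a b = (\<integral>\<^sup>+ s \<in> {a<..<b}. ennreal (norm (fst (v s))) \<partial>lebesgue)"
    by (rule riemannian_length_eq[OF N v])
  have "riemannian_length (\<lambda>s. \<phi> (\<gamma> s)) a b
      = (\<integral>\<^sup>+ s \<in> {a<..<b}. ennreal (norm (fst (A (v s)))) \<partial>lebesgue)"
    by (rule riemannian_length_eq[OF N v'])
  also have "\<dots> = (\<integral>\<^sup>+ s. ennreal m * (ennreal (norm (fst (v s))) * indicator {a<..<b} s) \<partial>lebesgue)"
    by (simp add: norm ennreal_mult \<open>m \<ge> 0\<close> mult.assoc)
  also have "\<dots> = ennreal m * riemannian_length \<gamma> a b"
    unfolding L using v by (intro nn_integral_cmult borel_measurable_speed[OF ac N \<open>a < b\<close>]) auto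
  finally show "riemannian_length (\<lambda>s. \<phi> (\<gamma> s)) a b = ennreal m * riemannian_length \<gamma> a b" .
qed

text \<open>Derivatives are taken only at interior points, so agreement on the closed interval
  suffices. This allows a glued curve to be treated piece by piece.\<close>

lemma horizontal_curve_cong:
  assumes eq: "\<And>s. s \<in> {a..b} \<Longrightarrow> \<gamma> s = \<eta> s" and hor: "horizontal_curve \<eta> a b"
  shows "horizontal_curve \<gamma> a b" "riemannian_length \<gamma> a b = riemannian_length \<eta> a b"
proof -
  obtain N v where ac: "absolutely_continuous_curve \<eta> a b" and N: "negligible N"
    and v: "\<And>s. s \<in> {a<..<b} - N \<Longrightarrow> (\<eta> has_vector_derivative v s) (at s) \<and> T_coeff (\<eta> s) (v s) = 0"
    using hor unfolding horizontal_curve_iff by blast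
  have v': "(\<gamma> has_vector_derivative v s) (at s) \<and> T_coeff (\<gamma> s) (v s) = 0"
    if s: "s \<in> {a<..<b} - N" for s
  proof
    show "(\<gamma> has_vector_derivative v s) (at s)"
      by (rule has_vector_derivative_transform_within_open[of \<eta> _ _ "{a<..<b}"])
         (use s v[OF s] eq in auto)
    show "T_coeff (\<gamma> s) (v s) = 0" using v[OF s] eq[of s] s by simp
  qed
  show "horizontal_curve \<gamma> a b"
    unfolding horizontal_curve_iff
    by (intro conjI exI[of _ N] exI[of _ v] ballI N v'[THEN conjunct1] v'[THEN conjunct2]
        absolutely_continuous_curve_cong[OF eq ac])
  show "riemannian_length \<gamma> a b = riemannian_length \<eta> a b"
    using riemannian_length_eq[OF N v] riemannian_length_eq[OF N v'] by simp
qed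

lemma horizontal_curve_shift:
  assumes hor: "horizontal_curve \<gamma> a b" and "a < b"
  shows "horizontal_curve (\<lambda>s. \<gamma> (s - k)) (a + k) (b + k)"
    "riemannian_length (\<lambda>s. \<gamma> (s - k)) (a + k) (b + k) = riemannian_length \<gamma> a b"
proof -
  obtain N v where ac: "absolutely_continuous_curve \<gamma> a b" and N: "negligible N"
    and v: "\<And>s. s \<in> {a<..<b} - N \<Longrightarrow> (\<gamma> has_vector_derivative v s) (at s) \<and> T_coeff (\<gamma> s) (v s) = 0"
    using hor unfolding horizontal_curve_iff by blast
  have N': "negligible ((+) k ` N)" using N by (rule negligible_translation)
  have v': "((\<lambda>s. \<gamma> (s - k)) has_vector_derivative v (s - k)) (at s) \<and> T_coeff (\<gamma> (s - k)) (v (s - k)) = 0"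
    if "s \<in> {a + k<..<b + k} - (+) k ` N" for s
  proof -
    have s: "s - k \<in> {a<..<b} - N" using that by (force simp: image_iff)
    have "((\<lambda>s. s - k) has_vector_derivative 1) (at s)"
      by (auto intro!: derivative_eq_intros)
    from vector_diff_chain_at[OF this conjunct1[OF v[OF s]]] v[OF s] show ?thesis
      by (simp add: o_def)
  qed
  show "horizontal_curve (\<lambda>s. \<gamma> (s - k)) (a + k) (b + k)"
    unfolding horizontal_curve_iff
    by (intro conjI exI[of _ "(+) k ` N"] exI[of _ "\<lambda>s. v (s - k)"] ballI N'
        v'[THEN conjunct1] v'[THEN conjunct2] absolutely_continuous_curve_shift[OF ac])
  let ?f = "\<lambda>s. ennreal (norm (fst (v s))) * indicator {a<..<b} s"
  have [measurable]: "?f \<in> borel_measurable lebesgue"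
    using v by (intro borel_measurable_speed[OF ac N \<open>a < b\<close>]) auto
  \<comment> \<open>The translation is written with slope 1 to match the general formula for affine
    images of Lebesgue measure.\<close>
  have [measurable]: "(\<lambda>x. - k + 1 * x) \<in> lebesgue \<rightarrow>\<^sub>M lebesgue"
    using lebesgue_measurable_scaling lebesgue_affine_measurable[of "\<lambda>_. 1" "- k"] by simp
  have "riemannian_length \<gamma> a b = (\<integral>\<^sup>+ s. ?f s \<partial>lebesgue)"
    by (rule riemannian_length_eq[OF N v])
  also have "lebesgue = distr lebesgue lebesgue (\<lambda>x. - k + 1 * x :: real)"
    using lebesgue_real_affine[of 1 "- k"] by (simp add: density_1)
  also have "(\<integral>\<^sup>+ s. ?f s \<partial>\<dots>) = (\<integral>\<^sup>+ s. ?f (- k + 1 * s) \<partial>lebesgue)"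
    by (rule nn_integral_distr) measurable
  also have "\<dots> = (\<integral>\<^sup>+ s \<in> {a + k<..<b + k}. ennreal (norm (fst (v (s - k)))) \<partial>lebesgue)"
    by (intro nn_integral_cong) (auto simp: indicator_def)
  also have "\<dots> = riemannian_length (\<lambda>s. \<gamma> (s - k)) (a + k) (b + k)"
    by (rule riemannian_length_eq[OF N' v', symmetric])
  finally show "riemannian_length (\<lambda>s. \<gamma> (s - k)) (a + k) (b + k) = riemannian_length \<gamma> a b" ..
qed

lemma horizontal_curve_join:
  assumes ab: "horizontal_curve \<gamma> a b" and bc: "horizontal_curve \<gamma> b c" and "a < b" "b < c"
  shows "horizontal_curve \<gamma> a c"
    "riemannian_length \<gamma> a c = riemannian_length \<gamma> a b + riemannian_length \<gamma> b c"
proof -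
  \<comment> \<open>One velocity function for both pieces, so that the two integrals can be
    added.\<close>
  define v where "v s = vector_derivative \<gamma> (at s)" for s
  obtain N w where ac: "absolutely_continuous_curve \<gamma> a b" and N: "negligible N"
    and "\<And>s. s \<in> {a<..<b} - N \<Longrightarrow> (\<gamma> has_vector_derivative w s) (at s) \<and> T_coeff (\<gamma> s) (w s) = 0"
    using ab unfolding horizontal_curve_iff by blast
  then have v: "\<And>s. s \<in> {a<..<b} - N \<Longrightarrow> (\<gamma> has_vector_derivative v s) (at s) \<and> T_coeff (\<gamma> s) (v s) = 0"
    unfolding v_def by (metis vector_derivative_at)
  obtain N' w' where ac': "absolutely_continuous_curve \<gamma> b c" and N': "negligible N'"
    and "\<And>s. s \<in> {b<..<c} - N' \<Longrightarrow> (\<gamma> has_vector_derivative w' s) (at s) \<and> T_coeff (\<gamma> s) (w' s) = 0"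
    using bc unfolding horizontal_curve_iff by blast
  then have v': "\<And>s. s \<in> {b<..<c} - N' \<Longrightarrow> (\<gamma> has_vector_derivative v s) (at s) \<and> T_coeff (\<gamma> s) (v s) = 0"
    unfolding v_def by (metis vector_derivative_at)
  let ?N = "N \<union> N' \<union> {b}"
  have N'': "negligible ?N" using N N' by simp
  have v'': "(\<gamma> has_vector_derivative v s) (at s) \<and> T_coeff (\<gamma> s) (v s) = 0"
    if "s \<in> {a<..<c} - ?N" for s
    using v[of s] v'[of s] that by (cases "s < b") auto
  show "horizontal_curve \<gamma> a c"
    unfolding horizontal_curve_iff
    by (intro conjI exI[of _ ?N] exI[of _ v] ballI N'' v''[THEN conjunct1] v''[THEN conjunct2]
        absolutely_continuous_curve_join[OF ac ac'] less_imp_le \<open>a < b\<close> \<open>b < c\<close>)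
  let ?f = "\<lambda>a b s. ennreal (norm (fst (v s))) * indicator {a<..<b} s"
  have "riemannian_length \<gamma> a c = (\<integral>\<^sup>+ s. ?f a c s \<partial>lebesgue)"
    by (rule riemannian_length_eq[OF N'' v''])
  also have "\<dots> = (\<integral>\<^sup>+ s. ?f a b s + ?f b c s \<partial>lebesgue)"
  proof (rule nn_integral_cong_AE)
    have "AE s in lebesgue. s \<notin> {b}"
      unfolding eventually_ae_filter_negligible by (intro exI[of _ "{b}"]) auto
    then show "AE s in lebesgue. ?f a c s = ?f a b s + ?f b c s"
      by (rule AE_mp, intro AE_I2) (use \<open>a < b\<close> \<open>b < c\<close> in \<open>auto simp: indicator_def\<close>)
  qed
  also have "\<dots> = (\<integral>\<^sup>+ s. ?f a b s \<partial>lebesgue) + (\<integral>\<^sup>+ s. ?f b c s \<partial>lebesgue)"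
    using v v' \<open>a < b\<close> \<open>b < c\<close>
    by (intro nn_integral_add borel_measurable_speed[OF ac N] borel_measurable_speed[OF ac' N']) auto
  also have "\<dots> = riemannian_length \<gamma> a b + riemannian_length \<gamma> b c"
    using riemannian_length_eq[OF N v] riemannian_length_eq[OF N' v'] by simp
  finally show "riemannian_length \<gamma> a c = riemannian_length \<gamma> a b + riemannian_length \<gamma> b c" .
qed

section \<open>Left translations, dilations and the triangle inequality\<close>

definition hmul :: "('n::finite) heis \<Rightarrow> 'n heis \<Rightarrow> 'n heis" where
  "hmul p q = (fst p + fst q, snd p + snd q + 2 * sympl (fst p) (fst q))"

lemma cc_dist_le:
  assumes "a < b" "horizontal_curve \<gamma> a b" "\<gamma> a = p" "\<gamma> b = q"
  shows "cc_dist p q \<le> riemannian_length \<gamma> a b"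
  unfolding cc_dist_def using assms by (intro Inf_lower) blast

lemma le_cc_distI:
  assumes "\<And>\<gamma> a b. \<lbrakk>a < b; horizontal_curve \<gamma> a b; \<gamma> a = p; \<gamma> b = q\<rbrakk> \<Longrightarrow> c \<le> riemannian_length \<gamma> a b"
  shows "c \<le> cc_dist p q"
  unfolding cc_dist_def by (rule Inf_greatest) (use assms in blast)

lemma cc_dist_lessE:
  assumes "cc_dist p q < e"
  obtains \<gamma> a b where "a < b" "horizontal_curve \<gamma> a b" "\<gamma> a = p" "\<gamma> b = q" "riemannian_length \<gamma> a b < e"
  using assms unfolding cc_dist_def Inf_less_iff by blast

text \<open>Two almost minimal curves, each within \<open>e / 2\<close> of its infimum, are glued
  after shifting the parameter of the second so that it starts at \<open>b\<close>.\<close>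

lemma cc_dist_triangle: "cc_dist p r \<le> cc_dist p q + cc_dist q r"
proof (rule ennreal_le_epsilon)
  fix e :: real assume fin: "cc_dist p q + cc_dist q r < top" and "0 < e"
  then have "cc_dist p q < cc_dist p q + ennreal (e / 2)" "cc_dist q r < cc_dist q r + ennreal (e / 2)"
    by (simp_all add: less_top[symmetric])
  then obtain \<gamma> a b \<eta> c d where
    \<gamma>: "a < b" "horizontal_curve \<gamma> a b" "\<gamma> a = p" "\<gamma> b = q" and
    \<gamma>l: "riemannian_length \<gamma> a b < cc_dist p q + ennreal (e / 2)" and
    \<eta>: "c < d" "horizontal_curve \<eta> c d" "\<eta> c = q" "\<eta> d = r" and
    \<eta>l: "riemannian_length \<eta> c d < cc_dist q r + ennreal (e / 2)"
    by (meson cc_dist_lessE)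
  define \<kappa> where "\<kappa> s = (if s \<le> b then \<gamma> s else \<eta> (s - (b - c)))" for s
  have l: "horizontal_curve \<kappa> a b" "riemannian_length \<kappa> a b = riemannian_length \<gamma> a b"
    using horizontal_curve_cong[OF _ \<gamma>(2), of \<kappa>] by (simp_all add: \<kappa>_def)
  have \<eta>': "horizontal_curve (\<lambda>s. \<eta> (s - (b - c))) b (d + (b - c))"
    "riemannian_length (\<lambda>s. \<eta> (s - (b - c))) b (d + (b - c)) = riemannian_length \<eta> c d"
    using horizontal_curve_shift[OF \<eta>(2,1), of "b - c"] by simp_all
  have r: "horizontal_curve \<kappa> b (d + (b - c))" "riemannian_length \<kappa> b (d + (b - c)) = riemannian_length \<eta> c d"
  proof -
    have "\<kappa> s = \<eta> (s - (b - c))" if "s \<in> {b..d + (b - c)}" for s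
      using that \<gamma>(4) \<eta>(3) by (cases "s = b") (auto simp: \<kappa>_def)
    from horizontal_curve_cong[OF this \<eta>'(1)] \<eta>'(2)
    show "horizontal_curve \<kappa> b (d + (b - c))" "riemannian_length \<kappa> b (d + (b - c)) = riemannian_length \<eta> c d"
      by simp_all
  qed
  have "cc_dist p r \<le> riemannian_length \<kappa> a (d + (b - c))"
    using \<gamma> \<eta> by (intro cc_dist_le horizontal_curve_join(1)[OF l(1) r(1)]) (auto simp: \<kappa>_def)
  also have "\<dots> = riemannian_length \<gamma> a b + riemannian_length \<eta> c d"
    using horizontal_curve_join(2)[OF l(1) r(1)] l(2) r(2) \<gamma>(1) \<eta>(1) by simp
  also have "\<dots> \<le> (cc_dist p q + ennreal (e / 2)) + (cc_dist q r + ennreal (e / 2))"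
    using \<gamma>l \<eta>l by (intro add_mono) auto
  also have "\<dots> = cc_dist p q + cc_dist q r + (ennreal (e / 2) + ennreal (e / 2))"
    by (simp add: ac_simps)
  also have "ennreal (e / 2) + ennreal (e / 2) = ennreal e"
    using \<open>0 < e\<close> by (subst ennreal_plus[symmetric]) auto
  finally show "cc_dist p r \<le> cc_dist p q + cc_dist q r + ennreal e" .
qed

lemma cc_dist_affine_image_le:
  fixes \<phi> A :: "('n::finite) heis \<Rightarrow> 'n heis"
  assumes "linear A" "\<And>p. \<phi> p = A p + c" "m > 0"
    and "\<And>p v. T_coeff p v = 0 \<Longrightarrow> T_coeff (\<phi> p) (A v) = 0"
    and "\<And>v. norm (fst (A v)) = m * norm (fst v)"
  shows "cc_dist (\<phi> p) (\<phi> q) \<le> ennreal m * cc_dist p q"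
proof -
  \<comment> \<open>Dividing by \<open>m\<close> first turns the claim into a lower bound for the
    lengths of curves from \<open>p\<close> to \<open>q\<close>, as the infimum requires.\<close>
  have "cc_dist (\<phi> p) (\<phi> q) / ennreal m \<le> cc_dist p q"
  proof (rule le_cc_distI)
    fix \<gamma> a b assume \<gamma>: "a < b" "horizontal_curve \<gamma> a b" "\<gamma> a = p" "\<gamma> b = q"
    have "cc_dist (\<phi> p) (\<phi> q) \<le> ennreal m * riemannian_length \<gamma> a b"
      using \<gamma> assms cc_dist_le[of a b "\<lambda>s. \<phi> (\<gamma> s)"] horizontal_curve_affine_image[of A \<phi> c m \<gamma> a b]
      by (simp add: less_imp_le)
    then show "cc_dist (\<phi> p) (\<phi> q) / ennreal m \<le> riemannian_length \<gamma> a b"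
      using \<open>m > 0\<close> by (intro divide_le_posI_ennreal) (auto simp: mult.commute)
  qed
  then have "cc_dist (\<phi> p) (\<phi> q) / ennreal m * ennreal m \<le> cc_dist p q * ennreal m"
    by (rule mult_right_mono) simp
  moreover have "x / ennreal m * ennreal m = x" for x
    using \<open>m > 0\<close> ennreal_divide_times[of x "ennreal m" "ennreal m"] by simp
  ultimately show ?thesis by (simp add: mult.commute)
qed

text \<open>Left translation is affine and preserves horizontality and horizontal norms, so it does
  not increase distances. Applying this to the inverse \<open>- g\<close> as well gives
  equality.\<close>

lemma cc_dist_left_translate: "cc_dist (hmul g p) (hmul g q) = cc_dist p q"
proof -
  have le: "cc_dist (hmul g p) (hmul g q) \<le> cc_dist p q" for g p q :: "'a heis"
  proof -
    have "cc_dist (hmul g p) (hmul g q) \<le> ennreal 1 * cc_dist p q"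
    proof (rule cc_dist_affine_image_le)
      show "linear (\<lambda>v. (fst v, snd v + 2 * sympl (fst g) (fst v)))"
        by (auto intro!: linearI simp: algebra_simps)
      show "hmul g p = (fst p, snd p + 2 * sympl (fst g) (fst p)) + g" for p
        by (simp add: hmul_def prod_eq_iff)
    qed (auto simp: hmul_def T_coeff_eq algebra_simps)
    then show ?thesis by simp
  qed
  have "hmul (- g) (hmul g p) = p" for p :: "'a heis"
    by (simp add: hmul_def prod_eq_iff)
  then show ?thesis
    using le[of g p q] le[of "- g" "hmul g p" "hmul g q"] by simp
qed

lemma cc_dist_eq_origin: "cc_dist p q = cc_dist 0 (hmul (- p) q)"
  using cc_dist_left_translate[of "- p" p q] by (simp add: hmul_def zero_prod_def)

lemma cc_dist_origin_hmul_le: "cc_dist 0 (hmul p q) \<le> cc_dist 0 p + cc_dist 0 q"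
  using cc_dist_triangle[of 0 "hmul p q" p] cc_dist_left_translate[of p 0 q] by (simp add: hmul_def)

text \<open>The vertical coordinate scales by the square of \<open>l\<close> because
  \<open>sympl\<close> is bilinear, so horizontal vectors stay horizontal and their norms scale by
  \<open>l\<close>.\<close>

lemma cc_dist_origin_dilation_le:
  assumes "l > 0"
  shows "cc_dist 0 (l *\<^sub>R z, l\<^sup>2 * t) \<le> ennreal l * cc_dist 0 (z, t)"
proof -
  let ?\<phi> = "\<lambda>v. (l *\<^sub>R fst v, l\<^sup>2 * snd v)"
  have "cc_dist (?\<phi> 0) (?\<phi> (z, t)) \<le> ennreal l * cc_dist 0 (z, t)"
  proof (rule cc_dist_affine_image_le)
    show "linear ?\<phi>"
      by (auto intro!: linearI simp: algebra_simps)
    show "?\<phi> p = ?\<phi> p + 0" for p :: "'a heis" by simp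
  qed (use assms in \<open>auto simp: T_coeff_eq algebra_simps power2_eq_square\<close>)
  then show ?thesis by (simp add: zero_prod_def)
qed

text \<open>The straight segment from the origin is horizontal because \<open>sympl z z = 0\<close>,
  and its length is \<open>norm z\<close>.\<close>

lemma cc_dist_origin_horizontal_le: "cc_dist 0 (z, 0) \<le> ennreal (norm z)"
proof -
  let ?\<gamma> = "\<lambda>s. (s *\<^sub>R z, 0 :: real)"
  have "(norm z)-lipschitz_on ((\<lambda>s. s) ` {0..1}) ?\<gamma>"
    by (intro lipschitz_onI) (auto simp: dist_Pair_Pair dist_norm scaleR_left_diff_distrib[symmetric])
  then have ac: "absolutely_continuous_curve ?\<gamma> 0 1"
    by (rule absolutely_continuous_curve_lipschitz_compose[OF absolutely_continuous_curve_id])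
  have v: "(?\<gamma> has_vector_derivative (z, 0)) (at s) \<and> T_coeff (?\<gamma> s) (z, 0) = 0" for s
    by (auto simp: T_coeff_eq intro!: derivative_eq_intros)
  have "horizontal_curve ?\<gamma> 0 1"
    unfolding horizontal_curve_iff using ac v by (intro conjI exI[of _ "{}"] exI[of _ "\<lambda>_. (z, 0)"]) auto
  then have "cc_dist 0 (z, 0) \<le> riemannian_length ?\<gamma> 0 1"
    by (intro cc_dist_le) (auto simp: zero_prod_def)
  also have "\<dots> = (\<integral>\<^sup>+ s \<in> {0<..<1 :: real}. ennreal (norm (fst (z, 0 :: real))) \<partial>lebesgue)"
    by (rule riemannian_length_eq[where N = "{}" and v = "\<lambda>_. (z, 0)", OF negligible_empty v])
  also have "\<dots> = ennreal (norm z)"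
    by (simp add: nn_integral_cmult_indicator)
  finally show ?thesis .
qed

text \<open>The vertical direction is reached by the commutator of two horizontal segments.\<close>

lemma cc_dist_origin_vertical_le: "cc_dist 0 (0 :: complex ^ 'n::finite, t) \<le> ennreal (2 * sqrt \<bar>t\<bar>)"
proof -
  define j :: 'n where "j = undefined"
  \<comment> \<open>Both vectors lie in one arbitrarily chosen complex coordinate line. The
    commutator has height \<open>4 * sympl u w\<close>; the factor \<open>sgn t\<close> makes this
    \<open>t\<close>, and four segments of length at most \<open>sqrt \<bar>t\<bar> / 2\<close> give
    the bound.\<close>
  define u w :: "complex ^ 'n" where
    "u = axis j (of_real (sqrt \<bar>t\<bar> / 2))" and "w = axis j (- \<i> * of_real (sgn t * sqrt \<bar>t\<bar> / 2))"
  have "sympl u w = (\<Sum>k\<in>UNIV. if k = j then sgn t * (sqrt \<bar>t\<bar> / 2) * (sqrt \<bar>t\<bar> / 2) else 0)"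
    unfolding sympl_def by (intro sum.cong) (auto simp: u_def w_def axis_def)
  also have "\<dots> = sgn t * (\<bar>t\<bar> / 4)" by simp
  also have "\<dots> = t / 4" by (simp add: sgn_if)
  finally have S: "4 * sympl u w = t" by simp
  have norm_axis: "norm (axis j c) = norm c" for c :: complex
    by (simp only: norm_eq_sqrt_inner inner_axis_axis) simp
  have n: "norm u \<le> sqrt \<bar>t\<bar> / 2" "norm w \<le> sqrt \<bar>t\<bar> / 2"
    by (auto simp: u_def w_def norm_axis norm_mult abs_sgn_eq)
  have "(0, t) = hmul (hmul (hmul (u, 0) (w, 0)) (- u, 0)) (- w, 0)"
    using S sympl_commute[of w u] by (simp add: hmul_def)
  also have "cc_dist 0 \<dots> \<le> cc_dist 0 (u, 0) + cc_dist 0 (w, 0) + cc_dist 0 (- u, 0) + cc_dist 0 (- w, 0)"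
    by (intro cc_dist_origin_hmul_le[THEN order_trans] add_right_mono order_refl)
  also have "\<dots> \<le> ennreal (sqrt \<bar>t\<bar> / 2) + ennreal (sqrt \<bar>t\<bar> / 2) + ennreal (sqrt \<bar>t\<bar> / 2) + ennreal (sqrt \<bar>t\<bar> / 2)"
    using n by (intro add_mono order_trans[OF cc_dist_origin_horizontal_le] ennreal_leI) auto
  also have "\<dots> = ennreal (2 * sqrt \<bar>t\<bar>)"
    by (simp add: ennreal_plus[symmetric] del: ennreal_plus)
  finally show ?thesis .
qed

text \<open>Moves first horizontally and then vertically. The bound yields finiteness of the
  distance and its continuity estimates.\<close>

lemma cc_dist_origin_le: "cc_dist 0 (z, t) \<le> ennreal (norm z + 2 * sqrt \<bar>t\<bar>)"
proof -
  have "(z, t) = hmul (z, 0) (0, t)" by (simp add: hmul_def)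
  also have "cc_dist 0 \<dots> \<le> cc_dist 0 (z, 0) + cc_dist 0 (0 :: complex ^ 'a, t)"
    by (rule cc_dist_origin_hmul_le)
  also have "\<dots> \<le> ennreal (norm z) + ennreal (2 * sqrt \<bar>t\<bar>)"
    by (intro add_mono cc_dist_origin_horizontal_le cc_dist_origin_vertical_le)
  finally show ?thesis by simp
qed

section \<open>The Koranyi gauge as a lower bound for the distance\<close>

text \<open>If the right side is finite, \<open>f'\<close> is Lebesgue integrable and its gauge
  integral, known from the fundamental theorem, equals the Lebesgue integral. Otherwise the bound is
  trivial.\<close>

lemma absolutely_continuous_curve_diff_le_nn_integral:
  fixes f G :: "real \<Rightarrow> real"
  assumes ac: "absolutely_continuous_curve f a b" and "a < b" and N: "negligible N"
    and f': "\<And>s. s \<in> {a<..<b} - N \<Longrightarrow> (f has_vector_derivative f' s) (at s)"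
    and G: "\<And>s. s \<in> {a<..<b} - N \<Longrightarrow> \<bar>f' s\<bar> \<le> G s"
  shows "ennreal (f b - f a) \<le> (\<integral>\<^sup>+ s \<in> {a<..<b}. ennreal (G s) \<partial>lebesgue)"
proof (cases "(\<integral>\<^sup>+ s \<in> {a<..<b}. ennreal (G s) \<partial>lebesgue) = \<infinity>")
  case False
  let ?g = "\<lambda>s. indicator {a<..<b} s *\<^sub>R f' s"
  have "(f' has_integral f b - f a) {a..b}"
    by (rule absolutely_continuous_curve_has_integral[OF ac, where N = "N \<union> {a, b}"])
       (use N f' \<open>a < b\<close> in auto)
  then have hi: "(f' has_integral f b - f a) {a<..<b}"
    by (simp add: has_integral_Icc_iff_Ioo)
  then have meas: "?g \<in> borel_measurable lebesgue"
    by (rule has_integral_implies_lebesgue_measurable)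
  have "AE s in lebesgue. s \<notin> N"
    using N by (auto simp: eventually_ae_filter_negligible)
  then have le: "(\<integral>\<^sup>+ s. ennreal (norm (?g s)) \<partial>lebesgue) \<le> (\<integral>\<^sup>+ s \<in> {a<..<b}. ennreal (G s) \<partial>lebesgue)"
    by (intro nn_integral_mono_AE) (auto simp: indicator_def G intro!: ennreal_leI elim: AE_mp)
  also have "\<dots> < \<infinity>" using False by (simp add: less_top)
  finally have int: "integrable lebesgue ?g"
    using meas by (intro integrableI_bounded)
  have "(?g has_integral f b - f a) UNIV"
  proof -
    have "?g = (\<lambda>s. if s \<in> {a<..<b} then f' s else 0)" by (auto simp: indicator_def)
    then show ?thesis using hi by (simp only: has_integral_restrict_UNIV)
  qed
  then have "integral\<^sup>L lebesgue ?g = f b - f a"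
    using has_integral_integral_lebesgue[OF int] has_integral_unique by blast
  then have "ennreal (f b - f a) \<le> ennreal (norm (integral\<^sup>L lebesgue ?g))"
    by (intro ennreal_leI) simp
  also have "\<dots> \<le> (\<integral>\<^sup>+ s. ennreal (norm (?g s)) \<partial>lebesgue)"
    using int by (rule integral_norm_bound_ennreal)
  finally show ?thesis using le by simp
qed simp

text \<open>The inner product and \<open>sympl\<close> are the real and imaginary parts of the
  Hermitian product, so this is the complex Cauchy-Schwarz inequality.\<close>

lemma inner_sympl_Cauchy_Schwarz: "(u \<bullet> v)\<^sup>2 + (sympl u v)\<^sup>2 \<le> (norm u)\<^sup>2 * (norm v)\<^sup>2"
proof -
  define h where "h = (\<Sum>j\<in>UNIV. u $ j * cnj (v $ j))"
  have "Re h = u \<bullet> v" "Im h = sympl u v"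
    by (simp_all add: h_def sympl_def inner_vec_def inner_complex_def)
  then have "(u \<bullet> v)\<^sup>2 + (sympl u v)\<^sup>2 = (norm h)\<^sup>2" by (simp add: cmod_power2)
  moreover have "norm h \<le> (\<Sum>j\<in>UNIV. \<bar>norm (u $ j)\<bar> * \<bar>norm (v $ j)\<bar>)"
    unfolding h_def by (rule sum_norm_le) (simp add: norm_mult)
  then have "norm h \<le> norm u * norm v"
    unfolding norm_vec_def by (rule order_trans) (rule L2_set_mult_ineq)
  then have "(norm h)\<^sup>2 \<le> (norm u * norm v)\<^sup>2" by (rule power_mono) simp
  ultimately show ?thesis by (simp add: power_mult_distrib)
qed

text \<open>The fourth power of the Koranyi gauge, a polynomial in the real coordinates and hence
  differentiable everywhere.\<close>

definition gauge4 :: "('n::finite) heis \<Rightarrow> real" where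
  "gauge4 p = (fst p \<bullet> fst p)\<^sup>2 + (snd p)\<^sup>2"

lemma gauge4_nonneg [simp]: "gauge4 p \<ge> 0"
  by (simp add: gauge4_def)

text \<open>The left side is a quarter of the derivative of \<open>gauge4\<close> along a horizontal
  velocity with projection \<open>u\<close>. Cauchy-Schwarz is used in the plane and then for the
  Hermitian product.\<close>

lemma gauge4_horizontal_derivative_le:
  "\<bar>(p1 \<bullet> p1) * (p1 \<bullet> u) + p2 * sympl p1 u\<bar> \<le> sqrt (gauge4 (p1, p2)) * (norm p1 * norm u)"
proof -
  have "\<bar>(p1 \<bullet> p1, p2) \<bullet> (p1 \<bullet> u, sympl p1 u)\<bar> \<le> norm (p1 \<bullet> p1, p2) * norm (p1 \<bullet> u, sympl p1 u)"
    by (rule Cauchy_Schwarz_ineq2)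
  also have "norm (p1 \<bullet> p1, p2) = sqrt (gauge4 (p1, p2))"
    by (simp add: norm_Pair gauge4_def)
  also have "norm (p1 \<bullet> u, sympl p1 u) \<le> norm p1 * norm u"
    unfolding norm_Pair
    by (rule real_le_lsqrt) (simp_all add: inner_sympl_Cauchy_Schwarz power_mult_distrib)
  finally show ?thesis
    by (simp add: mult_left_mono)
qed

lemma lipschitz_on_square:
  fixes f :: "'a::metric_space \<Rightarrow> real"
  assumes f: "C-lipschitz_on S f" and B: "\<And>x. x \<in> S \<Longrightarrow> \<bar>f x\<bar> \<le> B" and "B \<ge> 0"
  shows "(2 * B * C)-lipschitz_on S (\<lambda>x. (f x)\<^sup>2)"
proof (rule lipschitz_onI)
  fix x y assume xy: "x \<in> S" "y \<in> S"
  have "dist ((f x)\<^sup>2) ((f y)\<^sup>2) = \<bar>f x + f y\<bar> * \<bar>f x - f y\<bar>"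
    by (simp add: dist_real_def abs_mult[symmetric] power2_eq_square algebra_simps)
  also have "\<dots> \<le> (2 * B) * (C * dist x y)"
    using B[OF xy(1)] B[OF xy(2)] lipschitz_onD[OF f xy] \<open>B \<ge> 0\<close>
    by (intro mult_mono) (auto simp: dist_real_def)
  finally show "dist ((f x)\<^sup>2) ((f y)\<^sup>2) \<le> 2 * B * C * dist x y" by simp
qed (use assms(3) lipschitz_on_nonneg[OF f] in simp)

text \<open>The square root is Lipschitz only away from 0; the lower bound \<open>e\<close> comes
  from the smoothing of the gauge.\<close>

lemma lipschitz_on_sqrt:
  fixes f :: "'a::metric_space \<Rightarrow> real"
  assumes f: "C-lipschitz_on S f" and e: "\<And>x. x \<in> S \<Longrightarrow> e \<le> f x" and "e > 0"
  shows "(C / sqrt e)-lipschitz_on S (\<lambda>x. sqrt (f x))"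
proof (rule lipschitz_onI)
  fix x y assume xy: "x \<in> S" "y \<in> S"
  have pos: "f x > 0" "f y > 0" "sqrt e > 0" "sqrt e \<le> sqrt (f x)"
    using e[OF xy(1)] e[OF xy(2)] \<open>e > 0\<close> by auto
  have "dist (sqrt (f x)) (sqrt (f y)) * sqrt e \<le> \<bar>sqrt (f x) - sqrt (f y)\<bar> * (sqrt (f x) + sqrt (f y))"
    unfolding dist_real_def using pos by (intro mult_left_mono) (auto simp: add_increasing2)
  also have "\<dots> = \<bar>(sqrt (f x) - sqrt (f y)) * (sqrt (f x) + sqrt (f y))\<bar>"
    using pos by (simp add: abs_mult)
  also have "(sqrt (f x) - sqrt (f y)) * (sqrt (f x) + sqrt (f y)) = f x - f y"
    using pos by (simp add: algebra_simps)
  also have "\<bar>f x - f y\<bar> \<le> C * dist x y"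
    using lipschitz_onD[OF f xy] by (simp add: dist_real_def)
  finally show "dist (sqrt (f x)) (sqrt (f y)) \<le> C / sqrt e * dist x y"
    using pos by (simp add: field_simps)
qed (use assms(3) lipschitz_on_nonneg[OF f] in simp)

lemma gauge4_lipschitz_on_bounded:
  assumes "bounded S"
  shows "\<exists>C. C-lipschitz_on S gauge4"
proof -
  obtain B where B: "\<And>p. p \<in> S \<Longrightarrow> norm p \<le> B" and "B > 0"
    using assms unfolding bounded_pos by blast
  have f: "1-lipschitz_on S (\<lambda>p. norm (fst p))"
  proof (rule lipschitz_onI)
    fix p q :: "'a heis"
    have "\<bar>norm (fst p) - norm (fst q)\<bar> \<le> dist (fst p) (fst q)"
      by (simp add: dist_norm norm_triangle_ineq3)
    also have "\<dots> \<le> dist p q" by (rule dist_fst_le)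
    finally show "dist (norm (fst p)) (norm (fst q)) \<le> 1 * dist p q" by (simp add: dist_real_def)
  qed simp
  have s: "1-lipschitz_on S snd"
    by (rule lipschitz_onI) (auto simp: dist_snd_le)
  have B': "norm (fst p) \<le> B" "\<bar>snd p\<bar> \<le> B" if "p \<in> S" for p
    using B[OF that] norm_fst_le[of "fst p" "snd p"] norm_snd_le[of "snd p" "fst p"] by auto
  have "(2 * B\<^sup>2 * (2 * B * 1))-lipschitz_on S (\<lambda>p. ((norm (fst p))\<^sup>2)\<^sup>2)"
    using B' \<open>B > 0\<close> by (intro lipschitz_on_square f) (auto intro!: power_mono)
  moreover have "(2 * B * 1)-lipschitz_on S (\<lambda>p. (snd p)\<^sup>2)"
    using B' \<open>B > 0\<close> by (intro lipschitz_on_square s) auto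
  ultimately have "(2 * B\<^sup>2 * (2 * B * 1) + 2 * B * 1)-lipschitz_on S (\<lambda>p. ((norm (fst p))\<^sup>2)\<^sup>2 + (snd p)\<^sup>2)"
    by (rule lipschitz_on_add)
  then show ?thesis unfolding gauge4_def power2_norm_eq_inner by blast
qed

text \<open>The gauge is smoothed by \<open>e > 0\<close> because it is not differentiable at the origin.\<close>

lemma gauge_diff_le_riemannian_length:
  assumes hor: "horizontal_curve \<gamma> a b" and "a < b" and "e > 0"
  shows "ennreal (sqrt (sqrt (e + gauge4 (\<gamma> b))) - sqrt (sqrt (e + gauge4 (\<gamma> a)))) \<le> riemannian_length \<gamma> a b"
proof -
  obtain N v where ac: "absolutely_continuous_curve \<gamma> a b" and N: "negligible N"
    and v: "\<And>s. s \<in> {a<..<b} - N \<Longrightarrow> (\<gamma> has_vector_derivative v s) (at s) \<and> T_coeff (\<gamma> s) (v s) = 0"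
    using hor unfolding horizontal_curve_iff by blast
  let ?S = "\<gamma> ` {a..b}"
  have "bounded ?S"
    using absolutely_continuous_curve_imp_continuous_on[OF ac]
    by (intro compact_imp_bounded compact_continuous_image) auto
  then obtain C where C: "C-lipschitz_on ?S gauge4"
    using gauge4_lipschitz_on_bounded by blast
  have "(0 + C)-lipschitz_on ?S (\<lambda>p. e + gauge4 p)"
    by (intro lipschitz_on_add lipschitz_on_constant C)
  then have "((0 + C) / sqrt e / sqrt (sqrt e))-lipschitz_on ?S (\<lambda>p. sqrt (sqrt (e + gauge4 p)))"
    using \<open>e > 0\<close> by (intro lipschitz_on_sqrt) auto
  then have ac': "absolutely_continuous_curve (\<lambda>s. sqrt (sqrt (e + gauge4 (\<gamma> s)))) a b"
    by (rule absolutely_continuous_curve_lipschitz_compose[OF ac])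
  \<comment> \<open>A quarter of the derivative of \<open>M\<close>, so the fourth root of
    \<open>M\<close> has derivative \<open>D\<close> divided by the power 3/4 of
    \<open>M\<close>.\<close>
  define D where "D s = (let p = \<gamma> s; u = fst (v s) in
      (fst p \<bullet> fst p) * (fst p \<bullet> u) + snd p * sympl (fst p) u)" for s
  define M where "M s = e + gauge4 (\<gamma> s)" for s
  have M: "M s > 0" for s using \<open>e > 0\<close> by (simp add: M_def add_pos_nonneg)
  have "ennreal (sqrt (sqrt (M b)) - sqrt (sqrt (M a))) \<le> (\<integral>\<^sup>+ s \<in> {a<..<b}. ennreal (norm (fst (v s))) \<partial>lebesgue)"
  proof (rule absolutely_continuous_curve_diff_le_nn_integral[OF _ \<open>a < b\<close> N])
    show "absolutely_continuous_curve (\<lambda>s. sqrt (sqrt (M s))) a b" using ac' by (simp add: M_def)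
    fix s assume s: "s \<in> {a<..<b} - N"
    note v = v[OF s]
    have d1: "((\<lambda>s. fst (\<gamma> s)) has_vector_derivative fst (v s)) (at s)"
      using bounded_linear.has_vector_derivative[OF bounded_linear_fst conjunct1[OF v]] .
    have d2: "((\<lambda>s. snd (\<gamma> s)) has_real_derivative 2 * sympl (fst (\<gamma> s)) (fst (v s))) (at s)"
      using bounded_linear.has_vector_derivative[OF bounded_linear_snd conjunct1[OF v]] v
      by (simp add: has_real_derivative_iff_has_vector_derivative T_coeff_eq)
    have d3: "((\<lambda>s. fst (\<gamma> s) \<bullet> fst (\<gamma> s)) has_real_derivative 2 * (fst (\<gamma> s) \<bullet> fst (v s))) (at s)"
      using bounded_bilinear.has_vector_derivative[OF bounded_bilinear_inner d1 d1]
      by (simp add: has_real_derivative_iff_has_vector_derivative inner_commute)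
    have d4: "(M has_real_derivative 4 * D s) (at s)"
      unfolding M_def gauge4_def D_def Let_def
      by (rule derivative_eq_intros d2 d3 refl | simp add: algebra_simps)+
    show "((\<lambda>s. sqrt (sqrt (M s))) has_vector_derivative D s / (sqrt (M s) * sqrt (sqrt (M s)))) (at s)"
      unfolding has_real_derivative_iff_has_vector_derivative[symmetric]
      using M[of s] by (auto intro!: derivative_eq_intros d4 simp: field_simps)
    have "\<bar>D s\<bar> \<le> sqrt (gauge4 (\<gamma> s)) * (norm (fst (\<gamma> s)) * norm (fst (v s)))"
      unfolding D_def Let_def
      using gauge4_horizontal_derivative_le[of "fst (\<gamma> s)" "fst (v s)" "snd (\<gamma> s)"] by simp
    \<comment> \<open>Both \<open>gauge4\<close> and the fourth power of the horizontal norm are at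
      most \<open>M\<close>, which produces exactly the power 3/4 that cancels.\<close>
    also have "\<dots> \<le> sqrt (M s) * (sqrt (sqrt (M s)) * norm (fst (v s)))"
    proof (intro mult_mono mult_right_mono)
      show "sqrt (gauge4 (\<gamma> s)) \<le> sqrt (M s)" using \<open>e > 0\<close> by (simp add: M_def)
      have "(norm (fst (\<gamma> s)))\<^sup>2 = sqrt (((norm (fst (\<gamma> s)))\<^sup>2)\<^sup>2)"
        by (rule real_sqrt_unique[symmetric]) auto
      also have "\<dots> \<le> sqrt (M s)"
        using \<open>e > 0\<close> unfolding M_def gauge4_def power2_norm_eq_inner[symmetric]
        by (intro real_sqrt_le_mono) simp
      finally show "norm (fst (\<gamma> s)) \<le> sqrt (sqrt (M s))" by (rule real_le_rsqrt)
    qed (use M[of s] in auto)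
    finally show "\<bar>D s / (sqrt (M s) * sqrt (sqrt (M s)))\<bar> \<le> norm (fst (v s))"
      using M[of s] by (simp add: abs_mult field_simps)
  qed
  also have "\<dots> = riemannian_length \<gamma> a b"
    by (rule riemannian_length_eq[OF N v, symmetric])
  finally show ?thesis by (simp add: M_def)
qed

lemma gauge_le_cc_dist: "ennreal (sqrt (sqrt (gauge4 p))) \<le> cc_dist 0 p"
proof (rule le_cc_distI)
  fix \<gamma> a b assume \<gamma>: "a < b" "horizontal_curve \<gamma> a b" "\<gamma> a = 0" "\<gamma> b = p"
  show "ennreal (sqrt (sqrt (gauge4 p))) \<le> riemannian_length \<gamma> a b"
  proof (rule ennreal_le_epsilon)
    fix \<eta> :: real assume "0 < \<eta>"
    \<comment> \<open>The smoothing is the fourth power of \<open>\<eta>\<close>, so the smoothed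
      gauge equals \<open>\<eta>\<close> at the origin.\<close>
    let ?e = "(\<eta>\<^sup>2)\<^sup>2"
    have "sqrt ?e = \<eta>\<^sup>2" by (rule real_sqrt_unique) auto
    then have "sqrt (sqrt ?e) = \<eta>" using \<open>0 < \<eta>\<close> by simp
    moreover have "gauge4 (\<gamma> a) = 0" using \<gamma>(3) by (simp add: gauge4_def)
    ultimately have len: "ennreal (sqrt (sqrt (?e + gauge4 p)) - \<eta>) \<le> riemannian_length \<gamma> a b"
      using gauge_diff_le_riemannian_length[OF \<gamma>(2,1), of ?e] \<open>0 < \<eta>\<close> \<gamma>(4) by simp
    have "sqrt (sqrt ?e) \<le> sqrt (sqrt (?e + gauge4 p))"
      by (intro real_sqrt_le_mono) simp
    then have \<eta>: "\<eta> \<le> sqrt (sqrt (?e + gauge4 p))" unfolding \<open>sqrt (sqrt ?e) = \<eta>\<close> .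
    have "ennreal (sqrt (sqrt (gauge4 p))) \<le> ennreal ((sqrt (sqrt (?e + gauge4 p)) - \<eta>) + \<eta>)"
      by (intro ennreal_leI) simp
    also have "\<dots> = ennreal (sqrt (sqrt (?e + gauge4 p)) - \<eta>) + ennreal \<eta>"
      using \<eta> \<open>0 < \<eta>\<close> by (intro ennreal_plus) auto
    also have "\<dots> \<le> riemannian_length \<gamma> a b + ennreal \<eta>"
      using len by (rule add_right_mono)
    finally show "ennreal (sqrt (sqrt (gauge4 p))) \<le> riemannian_length \<gamma> a b + ennreal \<eta>" .
  qed
qed

section \<open>Strict monotonicity along vertical lines\<close>

lemma cc_dist_finite: "cc_dist p q < \<infinity>"
  using cc_dist_origin_le[of "fst (hmul (- p) q)" "snd (hmul (- p) q)"]
  unfolding cc_dist_eq_origin[of p q] by (simp add: le_less_trans)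

lemma norm_less_cc_dist_origin:
  assumes "t \<noteq> 0"
  shows "ennreal (norm z) < cc_dist 0 (z, t)"
proof -
  have "((norm z)\<^sup>2)\<^sup>2 < gauge4 (z, t)"
    unfolding gauge4_def power2_norm_eq_inner using assms by simp
  then have "norm z < sqrt (sqrt (gauge4 (z, t)))"
    by (intro real_less_rsqrt)
  then have "ennreal (norm z) < ennreal (sqrt (sqrt (gauge4 (z, t))))"
    by (simp add: ennreal_less_iff)
  then show ?thesis using gauge_le_cc_dist by (rule less_le_trans)
qed

text \<open>With \<open>l\<^sup>2 = t / t'\<close>, the point \<open>[z, t]\<close> is the product of the dilation \<open>[l z, t]\<close> of
  \<open>[z, t']\<close> and the horizontal point \<open>[(1 - l) z, 0]\<close>, so its distance to the origin is at most
  \<open>l d + (1 - l) |z|\<close> with \<open>d > |z|\<close> the distance of \<open>[z, t']\<close>.\<close>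

lemma cc_dist_origin_vertical_strict_mono:
  assumes "0 \<le> t \<and> t < t' \<or> t' < t \<and> t \<le> 0"
  shows "cc_dist 0 (z, t) < cc_dist 0 (z, t')"
proof -
  have "t' \<noteq> 0" using assms by auto
  note less = norm_less_cc_dist_origin[OF this, of z]
  show ?thesis
  proof (cases "t = 0")
    case True
    then show ?thesis using cc_dist_origin_horizontal_le[of z] less by (auto intro: le_less_trans)
  next
    case False
    define l where "l = sqrt (t / t')"
    have "0 < t / t'" "t / t' < 1"
      using assms False by (auto simp: divide_simps)
    then have l: "0 < l" "l < 1" "l\<^sup>2 * t' = t"
      using \<open>t' \<noteq> 0\<close> by (simp_all add: l_def)
    obtain d where d: "cc_dist 0 (z, t') = ennreal d" "d \<ge> 0"
      using cc_dist_finite[of 0 "(z, t')"] by (cases "cc_dist 0 (z, t')") auto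
    have "(z, t) = hmul (l *\<^sub>R z, l\<^sup>2 * t') ((1 - l) *\<^sub>R z, 0)"
      using l by (simp add: hmul_def scaleR_left_diff_distrib)
    then have "cc_dist 0 (z, t) \<le> cc_dist 0 (l *\<^sub>R z, l\<^sup>2 * t') + cc_dist 0 ((1 - l) *\<^sub>R z, 0)"
      using cc_dist_origin_hmul_le by simp
    also have "\<dots> \<le> ennreal l * ennreal d + ennreal ((1 - l) * norm z)"
      using cc_dist_origin_dilation_le[OF l(1), of z t'] cc_dist_origin_horizontal_le[of "(1 - l) *\<^sub>R z"] l d
      by (intro add_mono) auto
    also have "\<dots> = ennreal (l * d + (1 - l) * norm z)"
      using l d by (simp add: ennreal_mult)
    also have "\<dots> < ennreal d"
    proof -
      have "norm z < d" using less d by (simp add: ennreal_less_iff)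
      then have "(1 - l) * norm z < (1 - l) * d" using l by simp
      then have "l * d + (1 - l) * norm z < d" by (simp add: algebra_simps)
      moreover have "0 < d" using \<open>norm z < d\<close> norm_ge_zero[of z] by linarith
      ultimately show ?thesis by (intro ennreal_lessI)
    qed
    finally show ?thesis using d by simp
  qed
qed

lemma hmul_uminus_left: "hmul (- (z, s)) (w, r) = (w - z, r - s - 2 * sympl z w)"
  by (simp add: hmul_def)

text \<open>The distance depends on the heights only through the vertical offset \<open>x\<close> of
  the left-translated point. Its sign decides which of the two opposite spreads of the heights
  enlarges its absolute value.\<close>

lemma cc_dist_vertical_less_max:
  assumes "s1 \<le> s" "s \<le> s2" "r1 \<le> r" "r \<le> r2" "s1 < s \<and> s < s2 \<or> r1 < r \<and> r < r2"
  shows "cc_dist (z, s) (w, r) < max (cc_dist (z, s1) (w, r2)) (cc_dist (z, s2) (w, r1))"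
proof -
  define x where "x = r - s - 2 * sympl z w"
  have eq: "cc_dist (z, s) (w, r) = cc_dist 0 (w - z, r - s - 2 * sympl z w)" for s r
    unfolding cc_dist_eq_origin[of "(z, s)"] hmul_uminus_left ..
  show ?thesis
  proof (cases "x \<ge> 0")
    case True
    then have "cc_dist (z, s) (w, r) < cc_dist (z, s1) (w, r2)"
      unfolding eq using assms by (intro cc_dist_origin_vertical_strict_mono) (auto simp: x_def)
    then show ?thesis by (simp add: less_max_iff_disj)
  next
    case False
    then have "cc_dist (z, s) (w, r) < cc_dist (z, s2) (w, r1)"
      unfolding eq using assms by (intro cc_dist_origin_vertical_strict_mono) (auto simp: x_def)
    then show ?thesis by (simp add: less_max_iff_disj)
  qed
qed

text \<open>The inequalities are strict so that distance comparisons stay strict; points of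
  \<open>E\<close> itself may qualify.\<close>

definition vertically_between :: "('n::finite) heis set \<Rightarrow> 'n heis set" where
  "vertically_between E = {(z, t). \<exists>t1 t2. (z, t1) \<in> E \<and> (z, t2) \<in> E \<and> t1 < t \<and> t < t2}"

lemma cc_dist_le_diam: "p \<in> E \<Longrightarrow> q \<in> E \<Longrightarrow> cc_dist p q \<le> cc_diam E"
  unfolding cc_diam_def by (meson SUP_upper order_trans)

text \<open>Both orders of the arguments are covered, which spares a proof that
  \<open>cc_dist\<close> is symmetric.\<close>

lemma cc_dist_vertically_between_less_diam:
  assumes "k \<in> vertically_between E" "q \<in> E \<union> vertically_between E"
  shows "cc_dist k q < cc_diam E" "cc_dist q k < cc_diam E"
proof -
  obtain z s s1 s2 where k: "k = (z, s)" "(z, s1) \<in> E" "(z, s2) \<in> E" "s1 < s" "s < s2"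
    using assms(1) by (auto simp: vertically_between_def)
  obtain w r r1 r2 where q: "q = (w, r)" "(w, r1) \<in> E" "(w, r2) \<in> E" "r1 \<le> r" "r \<le> r2"
    using assms(2) by (cases q) (auto simp: vertically_between_def less_imp_le)
  have "cc_dist k q < max (cc_dist (z, s1) (w, r2)) (cc_dist (z, s2) (w, r1))"
    using k q by (auto intro!: cc_dist_vertical_less_max)
  also have "\<dots> \<le> cc_diam E" using k q by (simp add: cc_dist_le_diam)
  finally show "cc_dist k q < cc_diam E" .
  have "cc_dist q k < max (cc_dist (w, r1) (z, s2)) (cc_dist (w, r2) (z, s1))"
    using k q by (auto intro!: cc_dist_vertical_less_max)
  also have "\<dots> \<le> cc_diam E" using k q by (simp add: cc_dist_le_diam)
  finally show "cc_dist q k < cc_diam E" .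
qed

section \<open>Continuity of the distance\<close>

text \<open>An explicit upper bound for the distance, continuous in both points and zero on the
  diagonal. It links the distance to the Euclidean topology.\<close>

definition cc_bound :: "('n::finite) heis \<times> 'n heis \<Rightarrow> real" where
  "cc_bound x = norm (fst (snd x) - fst (fst x))
     + 2 * sqrt \<bar>snd (snd x) - snd (fst x) - 2 * sympl (fst (fst x)) (fst (snd x))\<bar>"

lemma cc_bound_refl [simp]: "cc_bound (p, p) = 0"
  by (simp add: cc_bound_def)

lemma cc_bound_nonneg [simp]: "cc_bound x \<ge> 0"
  by (simp add: cc_bound_def)

lemma cc_dist_le_bound: "cc_dist p q \<le> ennreal (cc_bound (p, q))"
  using cc_dist_origin_le[of "fst (hmul (- p) q)" "snd (hmul (- p) q)"]
  unfolding cc_dist_eq_origin[of p q]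
  by (cases p; cases q) (simp only: hmul_uminus_left, simp add: cc_bound_def)

lemma continuous_on_cc_bound [continuous_intros]:
  fixes f :: "'a::topological_space \<Rightarrow> ('n::finite) heis \<times> 'n heis"
  assumes "continuous_on S f"
  shows "continuous_on S (\<lambda>x. cc_bound (f x))"
proof -
  have "bounded_bilinear (sympl :: complex ^ 'n \<Rightarrow> _)"
    using bilinear_sympl by (simp add: bilinear_conv_bounded_bilinear)
  then show ?thesis
    unfolding cc_bound_def
    by (intro continuous_intros bounded_bilinear.continuous_on[of sympl] assms)
qed

text \<open>By the triangle inequality, moving both points raises the distance by at most two values
  of \<open>cc_bound\<close>, which are small near the given pair.\<close>

lemma open_cc_dist_less: "open {x :: ('n::finite) heis \<times> 'n heis. cc_dist (fst x) (snd x) < ennreal D}"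
proof (subst open_subopen, clarsimp)
  fix p1 :: "complex ^ 'n" and p2 q1 q2 assume less: "cc_dist (p1, p2) (q1, q2) < ennreal D"
  define p q where "p = (p1, p2)" and "q = (q1, q2)"
  obtain d where d: "cc_dist p q = ennreal d" "d \<ge> 0"
    using cc_dist_finite[of p q] by (cases "cc_dist p q") auto
  have "d < D" using less d by (simp add: p_def q_def ennreal_less_iff)
  let ?T = "{x. cc_bound (fst x, p) + cc_bound (q, snd x) < D - d}"
  have "open ?T" by (intro open_Collect_less continuous_intros)
  moreover have "(p, q) \<in> ?T" using \<open>d < D\<close> by simp
  moreover have "cc_dist (fst x) (snd x) < ennreal D" if "x \<in> ?T" for x
  proof -
    have "cc_dist (fst x) (snd x) \<le> cc_dist (fst x) p + (cc_dist p q + cc_dist q (snd x))"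
      by (meson add_left_mono cc_dist_triangle order_trans)
    also have "\<dots> \<le> ennreal (cc_bound (fst x, p)) + (ennreal d + ennreal (cc_bound (q, snd x)))"
      using d by (intro add_mono cc_dist_le_bound) auto
    also have "\<dots> = ennreal (cc_bound (fst x, p) + (d + cc_bound (q, snd x)))"
      using d by simp
    also have "\<dots> < ennreal D"
      using that d by (intro ennreal_lessI) (auto intro: le_less_trans[OF \<open>d \<ge> 0\<close> \<open>d < D\<close>])
    finally show ?thesis .
  qed
  ultimately show "\<exists>T. open T \<and> ((p1, p2), q1, q2) \<in> T \<and> T \<subseteq> {x. cc_dist (fst x) (snd x) < ennreal D}"
    unfolding p_def[symmetric] q_def[symmetric] by (intro exI[of _ ?T]) auto
qed

lemma cc_diam_compact_finite:
  assumes "compact E"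
  shows "cc_diam E < \<infinity>"
proof -
  have "bounded (cc_bound ` (E \<times> E))"
    using assms by (intro compact_imp_bounded compact_continuous_image compact_Times continuous_intros)
  then obtain B where B: "\<And>p q. p \<in> E \<Longrightarrow> q \<in> E \<Longrightarrow> cc_bound (p, q) \<le> B"
    unfolding bounded_iff by fastforce
  have "cc_diam E \<le> ennreal B"
    unfolding cc_diam_def
    by (intro SUP_least order_trans[OF cc_dist_le_bound] ennreal_leI B)
  then show ?thesis by (simp add: le_less_trans)
qed

section \<open>Filling a vertical gap\<close>

text \<open>Pairs with a member in \<open>K\<close> have distance strictly below the diameter. This
  is an open condition on a compact set of pairs, so it survives a uniform perturbation.\<close>

lemma ex_neighbourhood_cc_diam_le:
  assumes "compact E" "compact K" "K \<subseteq> vertically_between E"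
  shows "\<exists>\<delta>>0. cc_diam (E \<union> (\<Union>k\<in>K. ball k \<delta>)) \<le> cc_diam E"
proof -
  obtain D where D: "cc_diam E = ennreal D"
    using cc_diam_compact_finite[OF assms(1)] by (cases "cc_diam E") auto
  let ?O = "{x. cc_dist (fst x) (snd x) < ennreal D}"
  \<comment> \<open>Pairs with both members in \<open>E\<close> are not imposed, since they may
    realise the diameter.\<close>
  have compact: "compact (K \<times> (E \<union> K) \<union> (E \<union> K) \<times> K)"
    using assms by (intro compact_Un compact_Times)
  have "K \<times> (E \<union> K) \<union> (E \<union> K) \<times> K \<subseteq> ?O"
  proof
    fix x assume "x \<in> K \<times> (E \<union> K) \<union> (E \<union> K) \<times> K"
    then have "fst x \<in> vertically_between E \<and> snd x \<in> E \<union> vertically_between E \<or>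
        snd x \<in> vertically_between E \<and> fst x \<in> E \<union> vertically_between E"
      using assms(3) by auto
    then have "cc_dist (fst x) (snd x) < cc_diam E"
      using cc_dist_vertically_between_less_diam by blast
    then show "x \<in> ?O" using D by simp
  qed
  from compact_subset_open_imp_ball_epsilon_subset[OF compact open_cc_dist_less this]
  obtain \<epsilon> where "\<epsilon> > 0" and \<epsilon>: "(\<Union>x\<in>K \<times> (E \<union> K) \<union> (E \<union> K) \<times> K. ball x \<epsilon>) \<subseteq> ?O" .
  \<comment> \<open>Moving each point by less than \<open>\<epsilon> / 2\<close> moves the pair by
    less than \<open>\<epsilon>\<close>.\<close>
  have close: "cc_dist p q \<le> cc_diam E" if "dist k p < \<epsilon> / 2" "dist k' q < \<epsilon> / 2"
    "(k, k') \<in> K \<times> (E \<union> K) \<union> (E \<union> K) \<times> K" for p q k k'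
  proof -
    have "dist (k, k') (p, q) \<le> dist k p + dist k' q"
      by (simp add: dist_Pair_Pair sqrt_sum_squares_le_sum)
    then have "(p, q) \<in> ball (k, k') \<epsilon>" using that(1,2) by simp
    then have "(p, q) \<in> ?O" using \<epsilon> that(3) by blast
    then show ?thesis using D by simp
  qed
  have "cc_diam (E \<union> (\<Union>k\<in>K. ball k (\<epsilon> / 2))) \<le> cc_diam E"
    unfolding cc_diam_def[of "E \<union> _"]
  proof (intro SUP_least)
    fix p q assume pq: "p \<in> E \<union> (\<Union>k\<in>K. ball k (\<epsilon> / 2))" "q \<in> E \<union> (\<Union>k\<in>K. ball k (\<epsilon> / 2))"
    show "cc_dist p q \<le> cc_diam E"
    proof (cases "p \<in> E \<and> q \<in> E")
      case True
      then show ?thesis by (simp add: cc_dist_le_diam)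
    next
      case False
      \<comment> \<open>A point of \<open>E\<close> is its own centre. As \<open>p\<close> and
        \<open>q\<close> are not both in \<open>E\<close>, one of the two centres lies in
        \<open>K\<close>.\<close>
      have "\<exists>k. dist k x < \<epsilon> / 2 \<and> (k \<in> K \<or> k \<in> E \<and> x \<in> E)" if "x \<in> E \<union> (\<Union>k\<in>K. ball k (\<epsilon> / 2))" for x
      proof (cases "x \<in> E")
        case True
        then show ?thesis using \<open>\<epsilon> > 0\<close> by (intro exI[of _ x]) simp
      next
        case False
        then show ?thesis using that by auto
      qed
      then obtain k k' where "dist k p < \<epsilon> / 2" "k \<in> K \<or> k \<in> E \<and> p \<in> E"
          "dist k' q < \<epsilon> / 2" "k' \<in> K \<or> k' \<in> E \<and> q \<in> E"
        using pq by meson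
      then show ?thesis using False by (intro close[of k p k' q]) auto
    qed
  qed
  with \<open>\<epsilon> > 0\<close> show ?thesis by (intro exI[of _ "\<epsilon> / 2"]) auto
qed

text \<open>Otherwise a radius that keeps the diameter would give an admissible set of larger
  measure, against the maximality of \<open>E\<close>. The class is arbitrary so that both
  isodiametric problems are served.\<close>

lemma isodiametric_neighbourhood_not_in_class:
  fixes E :: "('n::finite) heis set"
  assumes E: "E \<in> isodiametric_sets_in \<C>" and K: "compact K" "K \<subseteq> vertically_between E"
    and p: "p \<in> K" "p \<notin> E"
  shows "\<exists>\<delta>>0. E \<union> (\<Union>k\<in>K. ball k \<delta>) \<notin> \<C>"
proof (rule ccontr)
  assume in_C: "\<not> ?thesis"
  have "compact E" and pos: "0 < cc_diam E" and
    meas: "outer_measure_of lebesgue E = isodiametric_constant \<C> * cc_diam E ^ (2 * CARD('n) + 2)"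
    using E by (auto simp: isodiametric_sets_in_def)
  obtain \<delta> where "\<delta> > 0" and le: "cc_diam (E \<union> (\<Union>k\<in>K. ball k \<delta>)) \<le> cc_diam E"
    using ex_neighbourhood_cc_diam_le[OF \<open>compact E\<close> K] by blast
  define U where "U = (\<Union>k\<in>K. ball k \<delta>)"
  have "cc_diam E \<le> cc_diam (E \<union> U)"
    unfolding cc_diam_def by (intro SUP_subset_mono SUP_mono) auto
  then have diam: "cc_diam (E \<union> U) = cc_diam E" using le unfolding U_def by simp
  have fin: "cc_diam E < \<infinity>" using \<open>compact E\<close> by (rule cc_diam_compact_finite)
  let ?Q = "cc_diam E ^ (2 * CARD('n) + 2)"
  have "?Q < top" using fin by (simp only: power_less_top_ennreal) simp
  then have Q: "?Q \<noteq> 0" "?Q \<noteq> \<infinity>" using pos by auto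
  have "E \<union> U \<in> \<C>" using in_C \<open>\<delta> > 0\<close> unfolding U_def by blast
  then have "outer_measure_of lebesgue (E \<union> U) / ?Q \<le> isodiametric_constant \<C>"
    unfolding isodiametric_constant_def using pos fin
    by (intro SUP_upper2[of "E \<union> U"]) (simp_all add: diam)
  then have "outer_measure_of lebesgue (E \<union> U) / ?Q * ?Q \<le> isodiametric_constant \<C> * ?Q"
    by (rule mult_right_mono) simp
  \<comment> \<open>Cancelling in \<open>ennreal\<close> needs the diameter to be positive and
    finite.\<close>
  moreover have "x / ?Q * ?Q = x" for x
    using Q by (simp only: ennreal_divide_times ennreal_divide_self[OF Q(1)] less_top[symmetric]
        infinity_ennreal_def mult_1_right not_False_eq_True)
  ultimately have le: "outer_measure_of lebesgue (E \<union> U) \<le> outer_measure_of lebesgue E"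
    using meas by simp
  \<comment> \<open>Removing the closed set \<open>E\<close> leaves an open set containing
    \<open>p\<close>, hence of positive measure.\<close>
  have "open U" "open (U - E)"
    using \<open>compact E\<close> by (auto simp: U_def compact_imp_closed intro!: open_Diff)
  have sets: "E \<in> sets lebesgue" "U \<in> sets lebesgue" "U - E \<in> sets lebesgue"
    using \<open>open U\<close> \<open>open (U - E)\<close> fmeasurableD[OF lmeasurable_compact[OF \<open>compact E\<close>]] by auto
  have "p \<in> U - E" using p \<open>\<delta> > 0\<close> by (auto simp: U_def intro: bexI[of _ p])
  then have "\<not> negligible (U - E)"
    using open_not_negligible[OF \<open>open (U - E)\<close>] by blast
  then have "emeasure lebesgue (U - E) \<noteq> 0"
    using sets by (simp add: negligible_iff_null_sets null_sets_def)
  moreover have "emeasure lebesgue E < \<infinity>"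
    using fmeasurableD2[OF lmeasurable_compact[OF \<open>compact E\<close>]] by (simp only: less_top infinity_ennreal_def)
  moreover have "emeasure lebesgue (E \<union> U) = emeasure lebesgue E + emeasure lebesgue (U - E)"
    using sets plus_emeasure[of E lebesgue "U - E"] by (simp add: Un_Diff_cancel)
  ultimately have "emeasure lebesgue E < emeasure lebesgue (E \<union> U)"
    by (simp add: less_top zero_less_iff_neq_zero)
  then show False using le sets by (simp add: sets.Un)
qed

section \<open>Rotations\<close>

text \<open>The orbit of \<open>p\<close> under all rotations, encoded by the moduli of the
  coordinates so that it is visibly closed and bounded.\<close>

definition torus_orbit :: "('n::finite) heis \<Rightarrow> 'n heis set" where
  "torus_orbit p = {q. snd q = snd p \<and> (\<forall>j. norm (fst q $ j) = norm (fst p $ j))}"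

lemma compact_torus_orbit: "compact (torus_orbit p)"
  unfolding compact_eq_bounded_closed
proof
  have "norm q \<le> norm (fst p) + \<bar>snd p\<bar>" if "q \<in> torus_orbit p" for q
  proof -
    have "norm (fst q) = norm (fst p)"
      using that by (simp add: torus_orbit_def norm_vec_def)
    then show ?thesis
      using norm_Pair_le[of "fst q" "snd q"] that by (simp add: torus_orbit_def)
  qed
  then show "bounded (torus_orbit p)" unfolding bounded_iff by blast
  have "torus_orbit p = {q. snd q = snd p} \<inter> (\<Inter>j. {q. norm (fst q $ j) = norm (fst p $ j)})"
    by (auto simp: torus_orbit_def)
  also have "closed \<dots>"
    by (intro closed_Int closed_INT ballI closed_Collect_eq continuous_intros)
  finally show "closed (torus_orbit p)" .
qed

text \<open>The angles are differences of arguments; at a zero coordinate any angle works.\<close>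

lemma torus_orbit_eq_rotation:
  assumes "q \<in> torus_orbit p"
  shows "\<exists>\<theta>. fst q = (\<chi> j. cis (\<theta> $ j) * fst p $ j)"
proof -
  have "fst q $ j = cis (Arg (fst q $ j) - Arg (fst p $ j)) * fst p $ j" for j
  proof -
    have "fst q $ j = rcis (norm (fst p $ j)) (Arg (fst q $ j))"
      using rcis_cmod_Arg[of "fst q $ j"] assms by (simp add: torus_orbit_def)
    also have "\<dots> = cis (Arg (fst q $ j) - Arg (fst p $ j)) * rcis (norm (fst p $ j)) (Arg (fst p $ j))"
      by (simp add: rcis_def cis_mult mult.left_commute)
    finally show ?thesis by (simp only: rcis_cmod_Arg)
  qed
  then show ?thesis
    by (intro exI[of _ "\<chi> j. Arg (fst q $ j) - Arg (fst p $ j)"]) (simp add: vec_eq_iff)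
qed

text \<open>A rotation preserves heights, so the one that takes \<open>p\<close> to \<open>q\<close>
  also carries the points of \<open>E\<close> above and below \<open>p\<close> to points of
  \<open>E\<close> above and below \<open>q\<close>.\<close>

lemma torus_orbit_vertically_between:
  assumes "E \<in> rotation_invariant_sets" "p \<in> vertically_between E"
  shows "torus_orbit p \<subseteq> vertically_between E"
proof
  fix q assume q: "q \<in> torus_orbit p"
  then obtain \<theta> where \<theta>: "fst q = (\<chi> j. cis (\<theta> $ j) * fst p $ j)"
    using torus_orbit_eq_rotation by blast
  have "(fst q, t) \<in> E" if "(fst p, t) \<in> E" for t
  proof -
    have "(fst q, t) = rotation \<theta> (fst p, t)" using \<theta> by (simp add: rotation_def)
    also have "\<dots> \<in> E" using assms(1) that by (auto simp: rotation_invariant_sets_def)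
    finally show ?thesis .
  qed
  moreover have "snd q = snd p" using q by (simp add: torus_orbit_def)
  ultimately show "q \<in> vertically_between E"
    using assms(2) by (cases p; cases q) (auto simp: vertically_between_def)
qed

lemma rotation_mem_torus_orbit:
  assumes "q \<in> torus_orbit p"
  shows "rotation \<theta> q \<in> torus_orbit p"
  using assms by (simp add: torus_orbit_def rotation_def norm_mult)

lemma dist_rotation: "dist (rotation \<theta> p) (rotation \<theta> q) = dist p q"
proof -
  have "dist (fst (rotation \<theta> p)) (fst (rotation \<theta> q)) = dist (fst p) (fst q)"
    unfolding dist_norm norm_vec_def
    by (simp add: rotation_def right_diff_distrib[symmetric] norm_mult)
  then show ?thesis by (simp add: dist_prod_def rotation_def)
qed

text \<open>Rotations are Euclidean isometries permuting the orbit, so they permute the balls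
  centred on it.\<close>

lemma rotation_invariant_Un_neighbourhood:
  assumes "E \<in> rotation_invariant_sets"
  shows "E \<union> (\<Union>k\<in>torus_orbit p. ball k \<delta>) \<in> rotation_invariant_sets"
  unfolding rotation_invariant_sets_def
proof (intro CollectI allI subsetI, elim imageE)
  fix \<theta> q r assume r: "r = rotation \<theta> q" and q: "q \<in> E \<union> (\<Union>k\<in>torus_orbit p. ball k \<delta>)"
  show "r \<in> E \<union> (\<Union>k\<in>torus_orbit p. ball k \<delta>)"
  proof (cases "q \<in> E")
    case True
    then show ?thesis using assms by (auto simp: rotation_invariant_sets_def r)
  next
    case False
    then obtain k where "k \<in> torus_orbit p" "dist k q < \<delta>" using q by auto
    then have "rotation \<theta> k \<in> torus_orbit p" "dist (rotation \<theta> k) r < \<delta>"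
      by (simp_all add: rotation_mem_torus_orbit dist_rotation r)
    then show ?thesis by auto
  qed
qed

theorem proposition3p11:
  fixes E :: "('n::finite) heis set"
  assumes "E \<in> isodiametric_sets \<union> rotation_invariant_isodiametric_sets"
  shows "t_convex E"
  unfolding t_convex_def
proof (intro allI impI, elim conjE, rule ccontr)
  fix z t1 t2 t
  assume "(z, t1) \<in> E" "(z, t2) \<in> E" "t1 \<le> t" "t \<le> t2" "(z, t) \<notin> E"
  then have "t1 < t" "t < t2" by (auto simp: order.strict_iff_order)
  then have p: "(z, t) \<in> vertically_between E"
    using \<open>(z, t1) \<in> E\<close> \<open>(z, t2) \<in> E\<close> by (auto simp: vertically_between_def)
  from assms show False
  proof
    assume "E \<in> isodiametric_sets"
    \<comment> \<open>Every enlargement belongs to \<open>UNIV\<close>, so a single point suffices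
      as the compact set.\<close>
    then show False
      using isodiametric_neighbourhood_not_in_class[of E UNIV "{(z, t)}" "(z, t)"] p \<open>(z, t) \<notin> E\<close>
      by (simp add: isodiametric_sets_def)
  next
    assume "E \<in> rotation_invariant_isodiametric_sets"
    then have E: "E \<in> isodiametric_sets_in rotation_invariant_sets" "E \<in> rotation_invariant_sets"
      by (auto simp: rotation_invariant_isodiametric_sets_def isodiametric_sets_in_def)
    have "(z, t) \<in> torus_orbit (z, t)" by (simp add: torus_orbit_def)
    then show False
      using isodiametric_neighbourhood_not_in_class[OF E(1) compact_torus_orbit
          torus_orbit_vertically_between[OF E(2) p]] \<open>(z, t) \<notin> E\<close>
        rotation_invariant_Un_neighbourhood[OF E(2)] by blast
  qed
qed

end
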